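(* Let $G$ be a normalized graph with nonnegative Ollivier Ricci curvature, maximum degree at most $3$ and diameter at least $6$. If $G$ is finite, then it is isometric (i.e. isomorphic as a graph) to a finite path, a simple cycle, a prism graph, a Möbius ladder or a restricted quasi-ladder. If $G$ is infinite, then it is isometric to the both-side infinite line, the one-side infinite line, the infinite ladder, or one of the five restricted infinite quasi-ladders.
   Context: All graphs are undirected, connected, locally finite and simple, $G=(V,E)$, with combinatorial distance $d$; $\deg(u)$ is the number of neighbors of $u$. A normalized graph has edge weights $1$ and vertex weights $m(u)=\deg(u)$. Its Ollivier Ricci curvature is $\kappa^O(u,v)=1-W(\mu_u,\mu_v)/d(u,v)$, where $\mu_u$ is the uniform probability measure on the neighbors of $u$ and $W(\mu,\nu)=\inf_A\sum_{u,v\in V}A(u,v)d(u,v)$ is the Wasserstein distance, the infimum being over all couplings $A:V\times V\to[0,1]$ with $\sum_vA(u,v)=\mu(u)$, $\sum_uA(u,v)=\nu(v)$. Nonnegative Ollivier Ricci curvature means $\kappa^O(u,v)\ge0$ for every edge $uv\in E$. Prism graph: Cartesian product $C_n\square K_2$ of a cycle and an edge. Möbius ladder: a cycle of even length $2n$ with each pair of antipodal vertices joined by an edge. Both-side infinite line: vertex set $\mathbb{Z}$, $n\sim n+1$. One-side infinite line: vertex set $\{0,1,2,\dots\}$, $n\sim n+1$. Infinite ladder: Cartesian product of the both-side infinite line with $K_2$. End modifications at a pair of adjacent vertices $(x,y)$ (with new vertices): (E1) nothing; (E2) attach one pendant vertex to exactly one of $x,y$; (E3) attach one pendant vertex to $x$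 and another one to $y$; (E4) add a vertex $z$ adjacent to $x$ and $y$; (E5) as (E4), and add a pendant vertex attached to $z$. Restricted quasi-ladder: a ladder with $m\ge1$ rungs (vertices $x_1,\dots,x_m,y_1,\dots,y_m$, edges $x_iy_i$ for $1\le i\le m$ and $x_ix_{i+1}$, $y_iy_{i+1}$ for $1\le i<m$) on which one of (E1)-(E5) is performed at $(x_1,y_1)$ and, independently and with disjoint new vertices, one of (E1)-(E5) at $(x_m,y_m)$. Restricted infinite quasi-ladders: the half-infinite ladder (vertices $x_n,y_n$, $n\ge0$; edges $x_ny_n$, $x_nx_{n+1}$, $y_ny_{n+1}$, $n\ge0$) with one of (E1)-(E5) performed at $(x_0,y_0)$. *)

theory Defs
  imports "HOL-Analysis.Infinite_Sum" "HOL-Library.Extended_Nat"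
begin

section \<open>Graphs\<close>

text \<open>An undirected edge \<open>uv\<close> is represented by the two ordered pairs \<open>(u, v)\<close> and \<open>(v, u)\<close>.\<close>

record 'a graph =
  verts :: "'a set"
  edges :: "('a \<times> 'a) set"

definition simple_graph :: "'a graph \<Rightarrow> bool" where
  "simple_graph G \<longleftrightarrow> edges G \<subseteq> verts G \<times> verts G \<and> sym (edges G) \<and> irrefl (edges G)"

definition nbrs :: "'a graph \<Rightarrow> 'a \<Rightarrow> 'a set" where
  "nbrs G u = {v. (u, v) \<in> edges G}"

definition deg :: "'a graph \<Rightarrow> 'a \<Rightarrow> nat" where
  "deg G u = card (nbrs G u)"

definition locally_finite_graph :: "'a graph \<Rightarrow> bool" where
  "locally_finite_graph G \<longleftrightarrow> (\<forall>u\<in>verts G. finite (nbrs G u))"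

definition connected_graph :: "'a graph \<Rightarrow> bool" where
  "connected_graph G \<longleftrightarrow> verts G \<noteq> {} \<and> (\<forall>u\<in>verts G. \<forall>v\<in>verts G. (u, v) \<in> (edges G)\<^sup>*)"

text \<open>
  \<open>(u, v) \<in> edges G ^^ n\<close> says that there is a walk of length \<open>n\<close> from \<open>u\<close> to \<open>v\<close>.
  The value of \<open>gdist\<close> is only meaningful for vertices in the same component.
\<close>

definition gdist :: "'a graph \<Rightarrow> 'a \<Rightarrow> 'a \<Rightarrow> nat" where
  "gdist G u v = (LEAST n. (u, v) \<in> edges G ^^ n)"

definition gdiameter :: "'a graph \<Rightarrow> enat" where
  "gdiameter G = (SUP u\<in>verts G. SUP v\<in>verts G. enat (gdist G u v))"

definition graph_isomorphic :: "'a graph \<Rightarrow> 'b graph \<Rightarrow> bool" where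
  "graph_isomorphic G H \<longleftrightarrow>
    (\<exists>f. bij_betw f (verts G) (verts H) \<and>
         (\<forall>u\<in>verts G. \<forall>v\<in>verts G. (u, v) \<in> edges G \<longleftrightarrow> (f u, f v) \<in> edges H))"


section \<open>Ollivier curvature of a normalized graph\<close>

text \<open>
  For edge weights \<open>1\<close> and vertex weights \<open>deg\<close>, the transition measure at \<open>u\<close> is the uniform
  distribution on the neighbours of \<open>u\<close> (with no mass at \<open>u\<close> itself).
\<close>

definition nbr_measure :: "'a graph \<Rightarrow> 'a \<Rightarrow> 'a \<Rightarrow> real" where
  "nbr_measure G u v = (if v \<in> nbrs G u then 1 / real (deg G u) else 0)"

definition couplings :: "'a set \<Rightarrow> ('a \<Rightarrow> real) \<Rightarrow> ('a \<Rightarrow> real) \<Rightarrow> ('a \<Rightarrow> 'a \<Rightarrow> real) set" where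
  "couplings V \<mu> \<nu> =
    {A. (\<forall>u\<in>V. \<forall>v\<in>V. 0 \<le> A u v \<and> A u v \<le> 1) \<and>
        (\<forall>u\<in>V. ((\<lambda>v. A u v) has_sum \<mu> u) V) \<and>
        (\<forall>v\<in>V. ((\<lambda>u. A u v) has_sum \<nu> v) V)}"

text \<open>
  Couplings of infinite cost do not contribute to the infimum. (Between finitely supported
  probability measures, the only ones used below, every coupling has finite cost.)
\<close>

definition wasserstein :: "'a graph \<Rightarrow> ('a \<Rightarrow> real) \<Rightarrow> ('a \<Rightarrow> real) \<Rightarrow> real" where
  "wasserstein G \<mu> \<nu> =
    Inf {c. \<exists>A\<in>couplings (verts G) \<mu> \<nu>.
              ((\<lambda>(u, v). A u v * real (gdist G u v)) has_sum c) (verts G \<times> verts G)}"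

definition ollivier_curvature :: "'a graph \<Rightarrow> 'a \<Rightarrow> 'a \<Rightarrow> real" where
  "ollivier_curvature G u v =
    1 - wasserstein G (nbr_measure G u) (nbr_measure G v) / real (gdist G u v)"

definition nonneg_ollivier_curvature :: "'a graph \<Rightarrow> bool" where
  "nonneg_ollivier_curvature G \<longleftrightarrow> (\<forall>(u, v)\<in>edges G. 0 \<le> ollivier_curvature G u v)"


section \<open>The model graphs\<close>

definition path_graph :: "nat \<Rightarrow> nat graph" where
  "path_graph n =
    \<lparr>verts = {..<n}, edges = {(i, j). i < n \<and> j < n \<and> (j = Suc i \<or> i = Suc j)}\<rparr>"

definition cycle_graph :: "nat \<Rightarrow> nat graph" where
  "cycle_graph n =
    \<lparr>verts = {..<n},
     edges = {(i, j). i < n \<and> j < n \<and> (j = Suc i mod n \<or> i = Suc j mod n)}\<rparr>"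

definition both_side_line :: "int graph" where
  "both_side_line = \<lparr>verts = UNIV, edges = {(i, j). j = i + 1 \<or> i = j + 1}\<rparr>"

definition one_side_line :: "nat graph" where
  "one_side_line = \<lparr>verts = UNIV, edges = {(i, j). j = Suc i \<or> i = Suc j}\<rparr>"

definition K2 :: "bool graph" where
  "K2 = \<lparr>verts = UNIV, edges = {(a, b). a \<noteq> b}\<rparr>"

definition cartesian_product :: "'a graph \<Rightarrow> 'b graph \<Rightarrow> ('a \<times> 'b) graph" where
  "cartesian_product G H =
    \<lparr>verts = verts G \<times> verts H,
     edges = {((a, b), (c, d)). a = c \<and> a \<in> verts G \<and> (b, d) \<in> edges H \<or>
                                (a, c) \<in> edges G \<and> b = d \<and> b \<in> verts H}\<rparr>"

definition prism_graph :: "nat \<Rightarrow> (nat \<times> bool) graph" where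
  "prism_graph n = cartesian_product (cycle_graph n) K2"

definition moebius_ladder :: "nat \<Rightarrow> nat graph" where
  "moebius_ladder n =
    \<lparr>verts = {..<2 * n},
     edges = edges (cycle_graph (2 * n)) \<union>
             {(i, j). i < 2 * n \<and> j < 2 * n \<and> (j = i + n \<or> i = j + n)}\<rparr>"

definition infinite_ladder :: "(int \<times> bool) graph" where
  "infinite_ladder = cartesian_product both_side_line K2"

text \<open>In both ladders below, \<open>x\<^sub>i = (i, False)\<close> and \<open>y\<^sub>i = (i, True)\<close>, with \<open>i\<close> starting at \<open>0\<close>.\<close>

definition finite_ladder :: "nat \<Rightarrow> (nat \<times> bool) graph" where
  "finite_ladder m = cartesian_product (path_graph m) K2"

definition half_infinite_ladder :: "(nat \<times> bool) graph" where
  "half_infinite_ladder = cartesian_product one_side_line K2"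


subsection \<open>End modifications\<close>

text \<open>
  The pendant vertex of (E2) may be attached to either vertex of the pair: \<open>E2_fst\<close> attaches it
  to \<open>x\<close> and \<open>E2_snd\<close> to \<open>y\<close>. The two choices have to be distinguished, because a finite ladder
  may carry one pendant vertex at each end, either on the same or on opposite sides.
\<close>

datatype end_modification = E1 | E2_fst | E2_snd | E3 | E4 | E5

text \<open>New vertices are \<open>Inr 0\<close> and \<open>Inr 1\<close>; in (E4) and (E5), the vertex \<open>z\<close> is \<open>Inr 0\<close>.\<close>

fun new_verts :: "end_modification \<Rightarrow> nat set" where
  "new_verts E1 = {}"
| "new_verts E2_fst = {0}"
| "new_verts E2_snd = {0}"
| "new_verts E3 = {0, 1}"
| "new_verts E4 = {0}"
| "new_verts E5 = {0, 1}"

fun new_edges :: "end_modification \<Rightarrow> 'a \<Rightarrow> 'a \<Rightarrow> (('a + nat) \<times> ('a + nat)) set" where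
  "new_edges E1 x y = {}"
| "new_edges E2_fst x y = {(Inl x, Inr 0)}"
| "new_edges E2_snd x y = {(Inl y, Inr 0)}"
| "new_edges E3 x y = {(Inl x, Inr 0), (Inl y, Inr 1)}"
| "new_edges E4 x y = {(Inl x, Inr 0), (Inl y, Inr 0)}"
| "new_edges E5 x y = {(Inl x, Inr 0), (Inl y, Inr 0), (Inr 0, Inr 1)}"

definition modify_end ::
    "end_modification \<Rightarrow> 'a \<Rightarrow> 'a \<Rightarrow> 'a graph \<Rightarrow> ('a + nat) graph" where
  "modify_end e x y G =
    \<lparr>verts = Inl ` verts G \<union> Inr ` new_verts e,
     edges = map_prod Inl Inl ` edges G \<union> new_edges e x y \<union> (new_edges e x y)\<inverse>\<rparr>"

text \<open>
  Applying \<open>modify_end\<close> twice nests the sum types, so the new vertices at the two ends are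
  disjoint, also for \<open>m = 1\<close>, where both modifications take place at the same pair.
\<close>

definition restricted_quasi_ladder ::
    "nat \<Rightarrow> end_modification \<Rightarrow> end_modification \<Rightarrow> (((nat \<times> bool) + nat) + nat) graph" where
  "restricted_quasi_ladder m e e' =
    modify_end e' (Inl (m - 1, False)) (Inl (m - 1, True))
      (modify_end e (0, False) (0, True) (finite_ladder m))"

text \<open>
  The choices \<open>E2_fst\<close> and \<open>E2_snd\<close> give isomorphic graphs here, so up to isomorphism there are
  five of these.
\<close>

definition restricted_infinite_quasi_ladder ::
    "end_modification \<Rightarrow> ((nat \<times> bool) + nat) graph" where
  "restricted_infinite_quasi_ladder e =
    modify_end e (0, False) (0, True) half_infinite_ladder"

end

theory Submission
  imports Defs
begin

text \<open>
  If an edge \<open>uv\<close> with \<open>1 / deg u + 1 / deg v < 1\<close> lies in no triangle and no 4-cycle, the indicators of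
  \<open>N(u) - {v}\<close> and \<open>N(v) - {u}\<close> are dual potentials showing that the Wasserstein distance exceeds \<open>1\<close>.
  Hence in \<open>G\<close> every edge whose ends have degrees 2 and 3, or 3 and 3, lies in a triangle or a 4-cycle.

  Take a geodesic \<open>w 0, \<dots>, w 6\<close>. If its midpoint has degree 2, the condition on short cycles spreads degree at
  most 2 to the whole graph, which is then a path, a cycle or a line. If the midpoint has degree 3, it lies in a
  ladder with three rungs, whose outer rungs are kept apart by the ends of the geodesic. Extend this ladder to a
  maximal one. Its interior vertices have no neighbours outside, so either its two ends are joined to each other,
  which gives a prism or a Moebius ladder, or the short cycles at each bounded end leave only the five end
  modifications.
\<close>

section \<open>Short cycles from nonnegative curvature\<close>

text \<open>The strict inequality on the degrees decides which edges stay unconstrained: for degrees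
  2 and 2 the reciprocals sum to exactly 1, and a pendant edge gives even more, so the potentials
  yield nothing there. This leaves room for arbitrarily long paths and cycles and for the pendant
  vertices of the end modifications. The length six comes from the outermost edges whose short
  cycles are needed, \<open>w 1 w 2\<close> and \<open>w 4 w 5\<close>. Their outer ends must have a
  second neighbour, supplied by \<open>w 0\<close> and \<open>w 6\<close>, and many contradictions
  arise because \<open>w 1\<close> and \<open>w 5\<close>, at distance 4, would be forced to share a
  neighbour. A short cycle says only that something closes up nearby. The local arguments therefore
  count: three known neighbours leave no room for another, and two candidates for the same free
  place coincide. Finite and infinite graphs are treated together: paths and ladders are indexed by
  intervals of integers, Zorn's lemma supplies maximal ones, and sizes are compared with the models
  only at the very end.\<close>

lemma gdist_edge:
  assumes "simple_graph G" "(u, v) \<in> edges G"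
  shows "gdist G u v = 1"
  unfolding gdist_def
proof (rule Least_equality)
  show "(u, v) \<in> edges G ^^ 1" using assms by simp
  fix n assume n: "(u, v) \<in> edges G ^^ n"
  have "u \<noteq> v" using assms by (auto simp: simple_graph_def irrefl_def)
  with n show "1 \<le> n" by (cases n) auto
qed

lemma walk_gdist:
  assumes "connected_graph G" "u \<in> verts G" "v \<in> verts G"
  shows "(u, v) \<in> edges G ^^ gdist G u v"
proof -
  have "(u, v) \<in> (edges G)\<^sup>*" using assms by (auto simp: connected_graph_def)
  then obtain n where "(u, v) \<in> edges G ^^ n" by (auto simp: rtrancl_power)
  then show ?thesis unfolding gdist_def by (rule LeastI)
qed

lemma gdist_le: "(u, v) \<in> edges G ^^ n \<Longrightarrow> gdist G u v \<le> n"
  unfolding gdist_def by (rule Least_le)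

text \<open>Weak Kantorovich duality for finitely supported measures: integrating an admissible pair
  of potentials against any coupling bounds its cost from below.\<close>

lemma wasserstein_lower_bound:
  fixes \<phi> \<psi> :: "'a \<Rightarrow> real"
  assumes N: "N \<subseteq> verts G" "finite N" and M: "M \<subseteq> verts G" "finite M"
    and \<mu>: "\<And>x. x \<notin> N \<Longrightarrow> \<mu> x = 0" "\<And>x. 0 \<le> \<mu> x" "sum \<mu> N = 1"
    and \<nu>: "\<And>x. x \<notin> M \<Longrightarrow> \<nu> x = 0" "\<And>x. 0 \<le> \<nu> x" "sum \<nu> M = 1"
    and pot: "\<And>x y. x \<in> N \<Longrightarrow> y \<in> M \<Longrightarrow> \<phi> x + \<psi> y \<le> real (gdist G x y)"
  shows "(\<Sum>x\<in>N. \<phi> x * \<mu> x) + (\<Sum>y\<in>M. \<psi> y * \<nu> y) \<le> wasserstein G \<mu> \<nu>"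
  unfolding wasserstein_def
proof (rule cInf_greatest)
  \<comment> \<open>The infimum of an empty set of reals carries no information, so a coupling of
    finite cost has to be exhibited; the product measure serves.\<close>
  let ?A = "\<lambda>x y. \<mu> x * \<nu> y"
  let ?V = "verts G"
  have le1: "\<mu> x \<le> 1" "\<nu> x \<le> 1" for x
    using member_le_sum[of x N \<mu>] member_le_sum[of x M \<nu>] \<mu> \<nu> N M
    by (cases "x \<in> N"; cases "x \<in> M"; force)+
  have "?A \<in> couplings ?V \<mu> \<nu>"
    unfolding couplings_def
  proof (intro CollectI conjI ballI)
    fix x y assume "x \<in> ?V" "y \<in> ?V"
    show "0 \<le> \<mu> x * \<nu> y" using \<mu> \<nu> by simp
    show "\<mu> x * \<nu> y \<le> 1" using le1 \<mu> \<nu> by (simp add: mult_le_one)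
  next
    fix x assume "x \<in> ?V"
    have "(\<nu> has_sum 1) ?V" using has_sum_finite_neutralI[of M ?V \<nu> 1] \<nu> M by auto
    from has_sum_cmult_right[OF this, of "\<mu> x"] show "((\<lambda>v. \<mu> x * \<nu> v) has_sum \<mu> x) ?V" by simp
    have "(\<mu> has_sum 1) ?V" using has_sum_finite_neutralI[of N ?V \<mu> 1] \<mu> N by auto
    from has_sum_cmult_left[OF this, of "\<nu> x"] show "((\<lambda>v. \<mu> v * \<nu> x) has_sum \<nu> x) ?V" by simp
  qed
  moreover have "((\<lambda>(x, y). ?A x y * real (gdist G x y)) has_sum
      (\<Sum>(x, y)\<in>N \<times> M. ?A x y * real (gdist G x y))) (?V \<times> ?V)"
    using N M \<mu>(1) \<nu>(1) by (intro has_sum_finite_neutralI) (auto, blast+)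
  ultimately show "{c. \<exists>A\<in>couplings ?V \<mu> \<nu>.
      ((\<lambda>(u, v). A u v * real (gdist G u v)) has_sum c) (?V \<times> ?V)} \<noteq> {}"
    unfolding ex_in_conv[symmetric] mem_Collect_eq by (intro exI bexI[of _ ?A])
next
  let ?V = "verts G"
  fix c assume "c \<in> {c. \<exists>A\<in>couplings ?V \<mu> \<nu>.
      ((\<lambda>(u, v). A u v * real (gdist G u v)) has_sum c) (?V \<times> ?V)}"
  then obtain A where A: "A \<in> couplings ?V \<mu> \<nu>"
    and c: "((\<lambda>(u, v). A u v * real (gdist G u v)) has_sum c) (?V \<times> ?V)"
    by blast
  have A0: "0 \<le> A x y" if "x \<in> ?V" "y \<in> ?V" for x y
    using A that by (auto simp: couplings_def)
  have rows: "((\<lambda>y. A x y) has_sum \<mu> x) ?V" if "x \<in> ?V" for x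
    using A that by (auto simp: couplings_def)
  have cols: "((\<lambda>x. A x y) has_sum \<nu> y) ?V" if "y \<in> ?V" for y
    using A that by (auto simp: couplings_def)
  \<comment> \<open>A nonnegative family with sum 0 vanishes, so every coupling lives on
    \<open>N \<times> M\<close> and all sums over \<open>verts G\<close> become finite ones.\<close>
  have zr: "A x y = 0" if "x \<in> ?V" "y \<in> ?V" "x \<notin> N" for x y
    using nonneg_has_sum_le_0D[of "\<lambda>y. A x y" ?V "\<mu> x" y] rows[of x] A0 that \<mu> by auto
  have zc: "A x y = 0" if "x \<in> ?V" "y \<in> ?V" "y \<notin> M" for x y
    using nonneg_has_sum_le_0D[of "\<lambda>x. A x y" ?V "\<nu> y" x] cols[of y] A0 that \<nu> by auto
  have row: "(\<Sum>y\<in>M. A x y) = \<mu> x" if "x \<in> N" for x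
  proof -
    have "((\<lambda>y. A x y) has_sum (\<Sum>y\<in>M. A x y)) ?V"
      using that N M zc by (intro has_sum_finite_neutralI) auto
    then show ?thesis using rows[of x] that N has_sum_unique by blast
  qed
  have col: "(\<Sum>x\<in>N. A x y) = \<nu> y" if "y \<in> M" for y
  proof -
    have "((\<lambda>x. A x y) has_sum (\<Sum>x\<in>N. A x y)) ?V"
      using that N M zr by (intro has_sum_finite_neutralI) auto
    then show ?thesis using cols[of y] that M has_sum_unique by blast
  qed
  have "((\<lambda>(x, y). A x y * real (gdist G x y)) has_sum
      (\<Sum>(x, y)\<in>N \<times> M. A x y * real (gdist G x y))) (?V \<times> ?V)"
    using N M zr zc by (intro has_sum_finite_neutralI) (auto, blast+)
  then have c_eq: "c = (\<Sum>(x, y)\<in>N \<times> M. A x y * real (gdist G x y))"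
    using c has_sum_unique by blast
  have "(\<Sum>x\<in>N. \<phi> x * \<mu> x) + (\<Sum>y\<in>M. \<psi> y * \<nu> y)
      = (\<Sum>x\<in>N. \<phi> x * (\<Sum>y\<in>M. A x y)) + (\<Sum>y\<in>M. \<psi> y * (\<Sum>x\<in>N. A x y))"
    by (simp add: row col)
  also have "\<dots> = (\<Sum>x\<in>N. \<Sum>y\<in>M. A x y * (\<phi> x + \<psi> y))"
    unfolding sum_distrib_left
    by (subst (2) sum.swap) (simp add: sum.distrib[symmetric] algebra_simps)
  also have "\<dots> \<le> (\<Sum>x\<in>N. \<Sum>y\<in>M. A x y * real (gdist G x y))"
    using N M by (intro sum_mono mult_left_mono pot A0) auto
  also have "\<dots> = c" by (simp add: c_eq sum.cartesian_product)
  finally show "(\<Sum>x\<in>N. \<phi> x * \<mu> x) + (\<Sum>y\<in>M. \<psi> y * \<nu> y) \<le> c" .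
qed

lemma nonneg_curvature_short_cycle:
  assumes simple: "simple_graph G" and conn: "connected_graph G"
    and uv: "(u, v) \<in> edges G" and fin: "finite (nbrs G u)" "finite (nbrs G v)"
    and curv: "0 \<le> ollivier_curvature G u v"
    and degs: "1 / real (deg G u) + 1 / real (deg G v) < 1"
  shows "\<exists>r s. (u, r) \<in> edges G \<and> r \<noteq> v \<and> (v, s) \<in> edges G \<and> s \<noteq> u \<and>
    (r = s \<or> (r, s) \<in> edges G)"
proof (rule ccontr)
  assume none: "\<not> ?thesis"
  let ?N = "nbrs G u" and ?M = "nbrs G v"
  let ?\<phi> = "\<lambda>x. if x = v then 0 else 1 :: real"
  let ?\<psi> = "\<lambda>y. if y = u then 0 else 1 :: real"
  have E: "(b, a) \<in> edges G \<and> a \<in> verts G \<and> b \<in> verts G \<and> a \<noteq> b" if "(a, b) \<in> edges G" for a b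
    using simple that unfolding simple_graph_def sym_def irrefl_def by blast
  have v: "v \<in> ?N" "u \<in> ?M" using uv E by (auto simp: nbrs_def)
  have d: "deg G u > 0" "deg G v > 0" using v fin by (auto simp: deg_def card_gt_0_iff)
  have "(\<Sum>x\<in>?N. ?\<phi> x * nbr_measure G u x) + (\<Sum>y\<in>?M. ?\<psi> y * nbr_measure G v y)
      \<le> wasserstein G (nbr_measure G u) (nbr_measure G v)"
  proof (rule wasserstein_lower_bound)
    fix x y assume x: "x \<in> ?N" and y: "y \<in> ?M"
    then have walk: "(x, y) \<in> edges G ^^ gdist G x y"
      using E by (intro walk_gdist conn) (auto simp: nbrs_def)
    have n0: "gdist G x y \<noteq> 0" if "x \<noteq> y" using walk that by (cases "gdist G x y") auto
    have n1: "(x, y) \<in> edges G" if "gdist G x y = Suc 0" using walk that by simp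
    consider "x = v" "y = u" | "x = v" "y \<noteq> u" | "x \<noteq> v" "y = u" | "x \<noteq> v" "y \<noteq> u" by blast
    then show "?\<phi> x + ?\<psi> y \<le> real (gdist G x y)"
    proof cases
      \<comment> \<open>The only case in which both potentials equal 1. Distances 0 and 1 would be a
        triangle and a 4-cycle through \<open>uv\<close>.\<close>
      case 4
      then have "x \<noteq> y" "(x, y) \<notin> edges G" using none x y by (auto simp: nbrs_def)
      then have "gdist G x y \<ge> 2" using n0 n1 by fastforce
      then show ?thesis using 4 by simp
    qed (use x y n0 E in \<open>force simp: nbrs_def\<close>)+
  qed (use fin d v E in \<open>auto simp: nbr_measure_def nbrs_def deg_def\<close>)
  \<comment> \<open>Since \<open>u\<close> and \<open>v\<close> have distance 1, nonnegative
    curvature is exactly the bound 1 on the Wasserstein distance.\<close>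
  also have "\<dots> \<le> 1"
    using curv gdist_edge[OF simple uv] by (simp add: ollivier_curvature_def)
  also have "(\<Sum>x\<in>?N. ?\<phi> x * nbr_measure G u x) = 1 - 1 / real (deg G u)"
    using fin(1) v d by (simp add: nbr_measure_def sum.remove[of ?N v] deg_def[symmetric] field_simps)
  also have "(\<Sum>y\<in>?M. ?\<psi> y * nbr_measure G v y) = 1 - 1 / real (deg G v)"
    using fin(2) v d by (simp add: nbr_measure_def sum.remove[of ?M u] deg_def[symmetric] field_simps)
  finally show False using degs by simp
qed

text \<open>\<open>short_cycle\<close> is all that is kept of the curvature. The witnesses
  \<open>a\<close>, \<open>b\<close>, \<open>c\<close> express that \<open>u\<close> has degree at
  least 2 and \<open>v\<close> at least 3; the roles are asymmetric, so an edge is often used in the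
  orientation for which the second neighbours are at hand.\<close>

locale flat_graph =
  fixes G :: "'a graph"
  assumes simple: "simple_graph G"
    and conn: "connected_graph G"
    and fin: "locally_finite_graph G"
    and deg3: "\<And>v. v \<in> verts G \<Longrightarrow> deg G v \<le> 3"
    and short_cycle: "\<And>u v a b c. \<lbrakk>(u, v) \<in> edges G; (u, a) \<in> edges G; a \<noteq> v;
      (v, b) \<in> edges G; (v, c) \<in> edges G; b \<noteq> u; c \<noteq> u; b \<noteq> c\<rbrakk> \<Longrightarrow>
      \<exists>r s. (u, r) \<in> edges G \<and> r \<noteq> v \<and> (v, s) \<in> edges G \<and> s \<noteq> u \<and> (r = s \<or> (r, s) \<in> edges G)"
begin

definition adj :: "'a \<Rightarrow> 'a \<Rightarrow> bool" (infix "~" 50) where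
  "u ~ v \<longleftrightarrow> (u, v) \<in> edges G"

lemma sym: "u ~ v \<Longrightarrow> v ~ u"
  using simple unfolding adj_def simple_graph_def sym_def by blast

lemma irrefl: "\<not> u ~ u"
  using simple unfolding adj_def simple_graph_def irrefl_def by blast

lemma adj_verts: "u ~ v \<Longrightarrow> u \<in> verts G \<and> v \<in> verts G"
  using simple unfolding adj_def simple_graph_def by blast

lemma card_nbrs: "u \<in> verts G \<Longrightarrow> finite (nbrs G u) \<and> card (nbrs G u) \<le> 3"
  using fin deg3[of u] unfolding locally_finite_graph_def deg_def by blast

lemma full: "\<lbrakk>u ~ a; u ~ b; u ~ c; a \<noteq> b; a \<noteq> c; b \<noteq> c; u ~ d\<rbrakk> \<Longrightarrow> d = a \<or> d = b \<or> d = c"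
proof (rule ccontr)
  assume *: "u ~ a" "u ~ b" "u ~ c" "a \<noteq> b" "a \<noteq> c" "b \<noteq> c" "u ~ d" "\<not> (d = a \<or> d = b \<or> d = c)"
  then have u: "finite (nbrs G u)" "card (nbrs G u) \<le> 3"
    using card_nbrs adj_verts by blast+
  with * have "card {a, b, c, d} \<le> card (nbrs G u)"
    by (intro card_mono) (auto simp: nbrs_def adj_def)
  then show False using * u by auto
qed

lemma short:
  assumes "u ~ v" "u ~ a" "a \<noteq> v" "v ~ b" "v ~ c" "b \<noteq> u" "c \<noteq> u" "b \<noteq> c"
  obtains r s where "u ~ r" "r \<noteq> v" "v ~ s" "s \<noteq> u" "r = s \<or> r ~ s"
  using short_cycle[of u v a b c] assms unfolding adj_def by blast

section \<open>Geodesics of length six\<close>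

text \<open>The last conjunct says that \<open>w i\<close> and \<open>w j\<close> have distance at
  least \<open>|i - j|\<close>. Speaking of walks instead of \<open>gdist\<close> makes short
  forbidden walks directly available, and the additive form avoids truncated subtraction.\<close>

definition geodesic :: "(nat \<Rightarrow> 'a) \<Rightarrow> nat \<Rightarrow> bool" where
  "geodesic w n \<longleftrightarrow> (\<forall>i\<le>n. w i \<in> verts G) \<and> (\<forall>i<n. w i ~ w (Suc i)) \<and>
     (\<forall>i\<le>n. \<forall>j\<le>n. \<forall>k. (w i, w j) \<in> edges G ^^ k \<longrightarrow> i \<le> j + k \<and> j \<le> i + k)"

lemma relpow_sym: "(u, v) \<in> edges G ^^ k \<Longrightarrow> (v, u) \<in> edges G ^^ k"
proof (induction k arbitrary: v)
  case (Suc k)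
  then obtain w where "(u, w) \<in> edges G ^^ k" "(w, v) \<in> edges G" by auto
  with Suc.IH have "(v, w) \<in> edges G" "(w, u) \<in> edges G ^^ k"
    using sym unfolding adj_def by auto
  then show ?case by (meson relpow_Suc_I2)
qed auto

lemma geodesic_exists:
  assumes "u \<in> verts G" "v \<in> verts G"
  obtains w where "geodesic w (gdist G u v)" "w 0 = u" "w (gdist G u v) = v"
proof -
  let ?n = "gdist G u v"
  from walk_gdist[OF conn assms] obtain w where w: "w 0 = u" "w ?n = v"
    "\<And>i. i < ?n \<Longrightarrow> (w i, w (Suc i)) \<in> edges G"
    by (auto simp: relpow_fun_conv)
  have sub: "(w i, w (i + k)) \<in> edges G ^^ k" if "i + k \<le> ?n" for i k
    using that by (induction k) (auto intro!: w)
  have V: "w i \<in> verts G" if "i \<le> ?n" for i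
    using that assms w adj_verts[of "w (i - 1)" "w i"] unfolding adj_def by (cases i) auto
  \<comment> \<open>A shortcut between two intermediate vertices, spliced between the initial and
    the final segment, would give a walk from \<open>u\<close> to \<open>v\<close> that is too
    short.\<close>
  have *: "j \<le> i + k" if "i \<le> ?n" "j \<le> ?n" "(w i, w j) \<in> edges G ^^ k" for i j k
  proof -
    have "(u, w i) \<in> edges G ^^ i" "(w j, v) \<in> edges G ^^ (?n - j)"
      using sub[of 0 i] sub[of j "?n - j"] that w by auto
    then have "(u, v) \<in> edges G ^^ (i + k + (?n - j))"
      using that(3) by (simp add: relpow_add) blast
    then have "?n \<le> i + k + (?n - j)" by (rule gdist_le)
    then show ?thesis using that by simp
  qed
  have "geodesic w ?n"
    unfolding geodesic_def using V w *  relpow_sym by (auto simp: adj_def)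
  then show ?thesis using that w by blast
qed

lemma geodesic_sub:
  assumes "geodesic w n" "k + m \<le> n"
  shows "geodesic (\<lambda>i. w (k + i)) m"
  using assms unfolding geodesic_def
  by (smt (verit) add.assoc add_Suc_right add_le_cancel_left le_trans less_le_trans nat_add_left_cancel_less)

text \<open>Transfers each argument about one half of a geodesic to the other half.\<close>

lemma geodesic_rev:
  assumes "geodesic w n"
  shows "geodesic (\<lambda>i. w (n - i)) n"
  unfolding geodesic_def
proof (intro conjI allI impI)
  fix i assume "i < n"
  then have "Suc (n - Suc i) = n - i" by simp
  then show "w (n - i) ~ w (n - Suc i)"
    using assms \<open>i < n\<close> unfolding geodesic_def by (metis diff_less zero_less_Suc less_le_trans not_less0 not_less sym less_imp_le)
next
  fix i j k assume "i \<le> n" "j \<le> n" "(w (n - i), w (n - j)) \<in> edges G ^^ k"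
  then have "n - i \<le> n - j + k" "n - j \<le> n - i + k"
    using assms unfolding geodesic_def by (meson diff_le_self)+
  then show "i \<le> j + k" "j \<le> i + k" using \<open>i \<le> n\<close> \<open>j \<le> n\<close> by auto
qed (use assms in \<open>auto simp: geodesic_def\<close>)

text \<open>The second to fifth facts exclude walks of length 0, 1, 2 and 3 between vertices of the
  geodesic that are farther apart; later proofs cite them by number.\<close>

lemma geodesic_facts:
  assumes "geodesic w n"
  shows "\<And>i. i < n \<Longrightarrow> w i ~ w (Suc i)"
    and "\<And>i j. i < j \<Longrightarrow> j \<le> n \<Longrightarrow> w i \<noteq> w j"
    and "\<And>i j. i + 1 < j \<Longrightarrow> j \<le> n \<Longrightarrow> \<not> w i ~ w j"
    and "\<And>i j a. i + 2 < j \<Longrightarrow> j \<le> n \<Longrightarrow> w i ~ a \<Longrightarrow> \<not> a ~ w j"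
    and "\<And>i j a b. i + 3 < j \<Longrightarrow> j \<le> n \<Longrightarrow> w i ~ a \<Longrightarrow> a ~ b \<Longrightarrow> \<not> b ~ w j"
proof -
  have g: "j \<le> i + k" if "i < j" "j \<le> n" "(w i, w j) \<in> edges G ^^ k" for i j k
    using assms that unfolding geodesic_def by (meson less_imp_le less_le_trans)
  show "\<And>i. i < n \<Longrightarrow> w i ~ w (Suc i)" using assms unfolding geodesic_def by blast
  show "w i \<noteq> w j" if "i < j" "j \<le> n" for i j
    using g[of i j 0] that by auto
  show "\<not> w i ~ w j" if "i + 1 < j" "j \<le> n" for i j
    using g[of i j 1] that unfolding adj_def by auto
  show "\<not> a ~ w j" if "i + 2 < j" "j \<le> n" "w i ~ a" for i j a
    using g[of i j 2] that unfolding adj_def by (auto simp: numeral_2_eq_2)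
  show "\<not> b ~ w j" if "i + 3 < j" "j \<le> n" "w i ~ a" "a ~ b" for i j a b
    using g[of i j 3] that unfolding adj_def by (auto simp: numeral_3_eq_3)
qed

lemma geodesic6:
  assumes "geodesic w 6"
  shows "w 0 ~ w 1" "w 1 ~ w 2" "w 2 ~ w 3" "w 3 ~ w 4" "w 4 ~ w 5" "w 5 ~ w 6"
  using geodesic_facts(1)[OF assms, of 0] geodesic_facts(1)[OF assms, of 1]
    geodesic_facts(1)[OF assms, of 2] geodesic_facts(1)[OF assms, of 3]
    geodesic_facts(1)[OF assms, of 4] geodesic_facts(1)[OF assms, of 5]
  by (simp_all add: eval_nat_numeral)

text \<open>Otherwise the short cycles through the edges \<open>w 1 w 2\<close> and \<open>w 4 w 5\<close> would give \<open>w 1\<close> and \<open>w 5\<close> a common neighbour.\<close>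

lemma geodesic_degree2_spread:
  assumes g: "geodesic w 6" and v3: "\<And>x. w 3 ~ x \<Longrightarrow> x = w 2 \<or> x = w 4"
    and a: "w 4 ~ a"
  shows "a = w 3 \<or> a = w 5"
proof (rule ccontr)
  assume na: "\<not> (a = w 3 \<or> a = w 5)"
  note e = geodesic6[OF g] geodesic6[OF g, THEN sym]
  note far = geodesic_facts[OF g]
  have neq: "w 3 \<noteq> w 5" "w 2 \<noteq> w 4" "w 1 \<noteq> w 3" "w 4 \<noteq> w 6" "w 0 \<noteq> w 2" "w 3 \<noteq> w 1"
    using far(2)[of 3 5] far(2)[of 2 4] far(2)[of 1 3] far(2)[of 4 6] far(2)[of 0 2] by auto
  obtain r s where "w 3 ~ r" "r \<noteq> w 4" "w 4 ~ s" "s \<noteq> w 3" "r = s \<or> r ~ s"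
    by (rule short[of "w 3" "w 4" "w 2" "w 5" a]) (use e a na neq in auto)
  \<comment> \<open>The only candidate for \<open>r\<close> is \<open>w 2\<close>, so
    \<open>s\<close> completes a 4-cycle \<open>w 2\<close>, \<open>w 3\<close>, \<open>w 4\<close>,
    \<open>s\<close>.\<close>
  then have s: "w 4 ~ s" "s \<noteq> w 3" "w 2 ~ s" "s \<noteq> w 5"
    using v3 far(3)[of 2 4] far(3)[of 2 5] far(3)[of 3 5] by (auto dest: sym)
  have s1: "s \<noteq> w 1" "s \<noteq> w 3" using s far(3)[of 1 4] by (auto dest: sym)
  obtain r1 s1 where 1: "w 1 ~ r1" "r1 \<noteq> w 2" "w 2 ~ s1" "s1 \<noteq> w 1" "r1 = s1 \<or> r1 ~ s1"
    by (rule short[of "w 1" "w 2" "w 0" "w 3" s]) (use e s s1 neq in auto)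
  have "s1 = w 3 \<or> s1 = s" using full[of "w 2" "w 1" "w 3" s s1] e s s1 neq 1 by auto
  then have r1: "r1 ~ s"
    using 1 v3 far(3)[of 1 3] far(3)[of 1 4] far(4)[of 1 4] s by (auto dest: sym)
  obtain r2 s2 where 2: "w 5 ~ r2" "r2 \<noteq> w 4" "w 4 ~ s2" "s2 \<noteq> w 5" "r2 = s2 \<or> r2 ~ s2"
    by (rule short[of "w 5" "w 4" "w 6" "w 3" s]) (use e s s1 neq in auto)
  have "s2 = w 3 \<or> s2 = s" using full[of "w 4" "w 5" "w 3" s s2] e s s1 neq 2 by auto
  then have r2: "r2 ~ s"
    using 2 v3 far(3)[of 3 5] far(3)[of 2 5] far(4)[of 2 5] s by (auto dest: sym)
  \<comment> \<open>Besides \<open>w 2\<close> and \<open>w 4\<close> there is room for one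
    neighbour of \<open>s\<close> only.\<close>
  have "r2 = r1"
    using full[of s "w 2" "w 4" r1 r2] s r1 r2 neq 1 2 far(3)[of 1 4] far(3)[of 2 5]
    by (auto dest: sym)
  then show False using far(4)[of 1 5] 1 2 by (auto dest: sym)
qed

text \<open>The short cycles through \<open>w 2 w 3\<close> and \<open>w 4 w 5\<close> would use the third neighbour of \<open>x\<close> and bring \<open>w 2\<close> and \<open>w 5\<close> within distance 2.\<close>

lemma geodesic_no_triangle:
  assumes g: "geodesic w 6" and x: "w 3 ~ x" "x ~ w 4"
  shows False
proof -
  note e = geodesic6[OF g] geodesic6[OF g, THEN sym]
  note far = geodesic_facts[OF g]
  have neq: "w 3 \<noteq> w 5" "w 2 \<noteq> w 4" "w 1 \<noteq> w 3" "w 4 \<noteq> w 6" "w 3 \<noteq> w 4"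
    using far(2)[of 3 5] far(2)[of 2 4] far(2)[of 1 3] far(2)[of 4 6] far(2)[of 3 4] by auto
  have x': "x \<noteq> w 2" "x \<noteq> w 4" "x \<noteq> w 5" "x \<noteq> w 3"
    using x far(3)[of 2 4] far(3)[of 3 5] irrefl by (auto dest: sym)
  obtain r s where 1: "w 5 ~ r" "r \<noteq> w 4" "w 4 ~ s" "s \<noteq> w 5" "r = s \<or> r ~ s"
    by (rule short[of "w 5" "w 4" "w 6" "w 3" x]) (use e x x' neq in \<open>auto dest: sym\<close>)
  have "s = w 3 \<or> s = x" using full[of "w 4" "w 5" "w 3" x s] e x x' neq 1 by (auto dest: sym)
  moreover have "r = w 2 \<or> r = x" if "r ~ w 3"
    using full[of "w 3" "w 2" "w 4" x r] e x x' neq 1 that by (auto dest: sym)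
  ultimately have A: "w 5 ~ x \<or> r ~ x"
    using 1 far(3)[of 3 5] far(3)[of 2 5] by (auto dest: sym)
  obtain r' s' where 2: "w 2 ~ r'" "r' \<noteq> w 3" "w 3 ~ s'" "s' \<noteq> w 2" "r' = s' \<or> r' ~ s'"
    by (rule short[of "w 2" "w 3" "w 1" "w 4" x]) (use e x x' neq in \<open>auto dest: sym\<close>)
  have "s' = w 4 \<or> s' = x" using full[of "w 3" "w 2" "w 4" x s'] e x x' neq 2 by (auto dest: sym)
  moreover have "r' = w 5 \<or> r' = x" if "r' ~ w 4"
    using full[of "w 4" "w 3" "w 5" x r'] e x x' neq 2 that by (auto dest: sym)
  ultimately have B: "w 2 ~ x \<or> r' ~ x"
    using 2 far(3)[of 2 4] far(3)[of 2 5] by (auto dest: sym)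
  have n: "r \<noteq> w 3" "r' \<noteq> w 4" "r \<noteq> w 2" "r' \<noteq> w 5"
    using 1 2 far(3)[of 3 5] far(3)[of 2 4] far(3)[of 2 5] by (auto dest: sym)
  \<comment> \<open>Triangle vertex \<open>x\<close> has a single free place, and \<open>A\<close>
    and \<open>B\<close> both claim it, one from the side of \<open>w 5\<close> and one from the
    side of \<open>w 2\<close>.\<close>
  have F: "d = w 3 \<or> d = w 4 \<or> d = c" if "x ~ c" "x ~ d" "c \<noteq> w 3" "c \<noteq> w 4" for c d
    using full[of x "w 3" "w 4" c d] x that neq by (auto dest: sym)
  have far25: "\<not> (w 2 ~ c \<and> c ~ w 5)" for c using far(4)[of 2 5] by auto
  have "x ~ w 5 \<or> x ~ r" "x ~ w 2 \<or> x ~ r'" using A B sym by blast+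
  then show False
    using F[of "w 5" "w 2"] F[of "w 5" r'] F[of r "w 2"] F[of r r'] far25[of x] far25[of r]
      n 1 2 neq x' e far(2)[of 2 3] far(2)[of 2 5] far(2)[of 4 5] by (auto dest: sym)
qed

text \<open>
  The condition on \<open>z\<close> keeps the two outer rungs far apart outside the middle one. It is what excludes
  sporadic small graphs when a ladder containing the block is analysed at its ends.
\<close>

definition block :: "'a \<Rightarrow> 'a \<Rightarrow> 'a \<Rightarrow> 'a \<Rightarrow> 'a \<Rightarrow> 'a \<Rightarrow> bool" where
  "block a0 a1 b0 b1 c0 c1 \<longleftrightarrow>
     a0 ~ a1 \<and> b0 ~ b1 \<and> c0 ~ c1 \<and> a0 ~ b0 \<and> a1 ~ b1 \<and> b0 ~ c0 \<and> b1 ~ c1 \<and>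
     a0 \<noteq> b1 \<and> a1 \<noteq> b0 \<and> b0 \<noteq> c1 \<and> b1 \<noteq> c0 \<and>
     (\<forall>a\<in>{a0, a1}. \<forall>c\<in>{c0, c1}. a \<noteq> c \<and> \<not> a ~ c \<and> (\<forall>z. a ~ z \<longrightarrow> z ~ c \<longrightarrow> z = b0 \<or> z = b1))"

lemma blockI:
  assumes "a0 ~ a1" "b0 ~ b1" "c0 ~ c1" "a0 ~ b0" "a1 ~ b1" "b0 ~ c0" "b1 ~ c1"
    and "a0 \<noteq> b1" "a1 \<noteq> b0" "b0 \<noteq> c1" "b1 \<noteq> c0" "a0 \<noteq> c0" "a0 \<noteq> c1" "a1 \<noteq> c0" "a1 \<noteq> c1"
    and "\<not> a0 ~ c0" "\<not> a0 ~ c1" "\<not> a1 ~ c0" "\<not> a1 ~ c1"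
    and "\<And>z. a0 ~ z \<Longrightarrow> z ~ c0 \<Longrightarrow> z = b0 \<or> z = b1" "\<And>z. a0 ~ z \<Longrightarrow> z ~ c1 \<Longrightarrow> z = b0 \<or> z = b1"
    and "\<And>z. a1 ~ z \<Longrightarrow> z ~ c0 \<Longrightarrow> z = b0 \<or> z = b1" "\<And>z. a1 ~ z \<Longrightarrow> z ~ c1 \<Longrightarrow> z = b0 \<or> z = b1"
  shows "block a0 a1 b0 b1 c0 c1"
  using assms unfolding block_def by blast

text \<open>In the next lemma the edge \<open>w 2 w 3\<close> of the geodesic is a rung; in \<open>block_turning\<close> below, \<open>w 4 w 5\<close> is one.\<close>

lemma block_crossing:
  assumes g: "geodesic w 6" and x: "w 3 ~ x" "x \<noteq> w 2" "x \<noteq> w 4"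
    and t: "w 2 ~ t" "t ~ w 4" "t \<noteq> w 3"
    and s: "w 1 ~ x" "w 5 ~ s" "s ~ t" "s \<noteq> w 4"
  shows "block (w 1) x (w 2) (w 3) t (w 4)"
proof -
  note e = geodesic6[OF g] geodesic6[OF g, THEN sym]
  note far = geodesic_facts[OF g]
  have nx: "\<not> x ~ w 4" "\<not> x ~ w 5"
    using geodesic_no_triangle[OF g x(1)] far(4)[of 1 5] s by auto
  have nt: "\<not> w 1 ~ t" "t \<noteq> x" "\<not> w 1 ~ w 4" "t \<noteq> w 5"
    using far(4)[of 1 4] far(3)[of 1 4] far(3)[of 2 5] t nx by (auto dest: sym)
  have s': "s \<noteq> x" "s \<noteq> w 2" "s \<noteq> w 4"  "\<not> s ~ w 1"
    using far(4)[of 1 5] far(3)[of 2 5] nx s t  nt far(5)[of 1 5 x s] by (auto dest: sym)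
  \<comment> \<open>With \<open>s\<close> the neighbours of \<open>t\<close> are exhausted. Neither
    \<open>w 1\<close> nor \<open>x\<close> is adjacent to \<open>w 4\<close> or \<open>s\<close>,
    so a detour from the first rung to \<open>t\<close> can only use \<open>w 2\<close>.\<close>
  have T: "z = w 2 \<or> z = w 4 \<or> z = s" if "t ~ z" for z
    using full[of t "w 2" "w 4" s z] that t s s' e far(2)[of 2 4] by (auto dest: sym)
  have W: "z = w 3 \<or> z = w 5 \<or> z = t" if "w 4 ~ z" for z
    using full[of "w 4" "w 3" "w 5" t z] that t nt e far(2)[of 3 5] by (auto dest: sym)
  have xt: "\<not> x ~ t" "\<not> x ~ s"
    using T[of x] x s' far(5)[of 1 5 x s] s by (auto dest: sym)
  have n: "w 1 \<noteq> w 3" "x \<noteq> w 2" "w 2 \<noteq> w 4" "w 3 \<noteq> t" "w 1 \<noteq> t" "w 1 \<noteq> w 4" "x \<noteq> t" "x \<noteq> w 4"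
    "w 3 ~ w 2"
    using far(2)[of 1 3] far(2)[of 2 4] x t s' nt far(2)[of 1 4] far(3)[of 1 5] s e by (auto dest: sym)
  have "z = w 2 \<or> z = w 3" if "w 1 ~ z" "z ~ t" for z
    using T[of z] that nt s' sym by metis
  moreover have "z = w 2 \<or> z = w 3" if "w 1 ~ z" "z ~ w 4" for z
    using that far(4)[of 1 4] by auto
  moreover have "z = w 2 \<or> z = w 3" if "x ~ z" "z ~ t" for z
    using T[of z] that nx xt sym by metis
  moreover have "z = w 2 \<or> z = w 3" if "x ~ z" "z ~ w 4" for z
    using W[of z] that nx xt sym by metis
  ultimately show ?thesis
    using e n nt nx xt x(1) t s(1) sym by (intro blockI) metis+
qed

text \<open>The two ways in which the short cycle through \<open>w 1 w 2\<close> can leave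
  \<open>w 2\<close>: towards \<open>w 3\<close>, and then it returns through \<open>x\<close>
  because \<open>w 4\<close> is too far from \<open>w 1\<close>, or towards the third neighbour
  \<open>t\<close>.\<close>

lemma geodesic_short_left:
  assumes g: "geodesic w 6" and t: "w 2 ~ t" "t \<noteq> w 1" "t \<noteq> w 3"
    and x: "w 3 ~ x" "x \<noteq> w 2" "x \<noteq> w 4" and nt: "\<not> w 1 ~ t"
  obtains "w 1 ~ x" | z where "w 1 ~ z" "z ~ t" "z \<noteq> w 2"
proof -
  note e = geodesic6[OF g] geodesic6[OF g, THEN sym]
  note far = geodesic_facts[OF g]
  obtain r s where 1: "w 1 ~ r" "r \<noteq> w 2" "w 2 ~ s" "s \<noteq> w 1" "r = s \<or> r ~ s"
    by (rule short[of "w 1" "w 2" "w 0" "w 3" t]) (use e t far(2)[of 0 2] far(2)[of 1 3] in \<open>auto dest: sym\<close>)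
  have "s = w 3 \<or> s = t" using full[of "w 2" "w 1" "w 3" t s] e t 1 far(2)[of 1 3] by (auto dest: sym)
  moreover have "r = w 4 \<or> r = x" if "r ~ w 3"
    using full[of "w 3" "w 2" "w 4" x r] e x 1 that far(2)[of 2 4] by (auto dest: sym)
  ultimately show ?thesis using 1 that nt far(3)[of 1 4] far(3)[of 1 3] by auto
qed

text \<open>Here the geodesic runs along one side of the ladder. The work lies in separating
  \<open>s\<close> from \<open>t\<close>: an edge between them, or a common neighbour other than
  \<open>x\<close>, uses up their degrees. The short cycles through \<open>w 1 w 2\<close> and
  \<open>w 4 w 5\<close> then have no place left, or they give \<open>w 1\<close> and
  \<open>w 5\<close> a common neighbour.\<close>

lemma block_straight:
  assumes g: "geodesic w 6" and x: "w 3 ~ x" "x \<noteq> w 2" "x \<noteq> w 4"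
    and no: "\<And>t. w 2 ~ t \<Longrightarrow> t ~ w 4 \<Longrightarrow> t = w 3"
    and s: "w 2 ~ s" "s ~ x" "s \<noteq> w 1" "s \<noteq> w 3"
    and t: "w 4 ~ t" "t ~ x" "t \<noteq> w 5" "t \<noteq> w 3"
  shows "block (w 2) s (w 3) x (w 4) t"
proof -
  note e = geodesic6[OF g] geodesic6[OF g, THEN sym]
  note far = geodesic_facts[OF g]
  note gr = geodesic_rev[OF g]
  have st: "s \<noteq> t" "\<not> w 2 ~ t" "\<not> s ~ w 4" using no s t by (auto dest: sym)
  have X: "z = w 3 \<or> z = s \<or> z = t" if "x ~ z" for z
    using full[of x "w 3" s t z] that s t x st by (auto dest: sym)
  have n: "w 1 \<noteq> t" "w 5 \<noteq> s" "x \<noteq> w 1" "x \<noteq> w 5" "\<not> w 1 ~ x" "\<not> w 5 ~ x" "\<not> w 1 ~ t" "\<not> w 5 ~ s"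
    "\<not> x ~ w 2" "\<not> x ~ w 4" "s \<noteq> w 4" "t \<noteq> w 2"
    using far(3)[of 1 4] far(3)[of 2 5] far(3)[of 1 3] far(3)[of 3 5] far(4)[of 1 4] far(4)[of 2 5] s t x
      X[of "w 1"] X[of "w 5"] X[of "w 2"] X[of "w 4"] far(2)[of 1 3] far(2)[of 3 5] far(3)[of 2 4] irrefl
      far(2)[of 2 3] far(2)[of 3 4]
    by (auto dest: sym)
  have sx: "s \<noteq> x" "t \<noteq> x" using s t irrefl by auto
  have nst: "\<not> s ~ t"
  proof
    assume "s ~ t"
    then have S: "d = w 2 \<or> d = x \<or> d = t" if "s ~ d" for d
      using full[of s "w 2" x t d] that s x n sx by (auto dest: sym)
    have "\<not> w 1 ~ s" using S[of "w 1"] n far(2)[of 1 2] by (auto dest: sym)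
    then show False
      by (rule geodesic_short_left[OF g s(1,3,4) x]) (use n S in \<open>auto dest: sym\<close>)
  qed
  have key: False if z: "s ~ z" "z ~ t" "z \<noteq> x" for z
  proof -
    have zn: "z \<noteq> w 2" "z \<noteq> w 4" "z \<noteq> w 1" "z \<noteq> w 5" using z n st s t far(4)[of 1 4] far(4)[of 2 5] by (auto dest: sym)
    have S: "d = w 2 \<or> d = x \<or> d = z" if "s ~ d" for d
      using full[of s "w 2" x z d] that s x z zn by (auto dest: sym)
    have T: "d = w 4 \<or> d = x \<or> d = z" if "t ~ d" for d
      using full[of t "w 4" x z d] that t x z zn by (auto dest: sym)
    have "\<not> w 1 ~ s" using S[of "w 1"] n zn far(2)[of 1 2] by (auto dest: sym)
    then have "w 1 ~ z"
      by (rule geodesic_short_left[OF g s(1,3,4) x]) (use n S in \<open>auto dest: sym\<close>)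
    have "\<not> w 5 ~ t" using T[of "w 5"] n zn far(2)[of 4 5] by (auto dest: sym)
    then have "w 5 ~ x \<or> (\<exists>y. w 5 ~ y \<and> y ~ t \<and> y \<noteq> w 4)"
      using geodesic_short_left[OF gr, of t x] t x by auto
    then have "w 5 ~ z" using n T by (auto dest: sym)
    with \<open>w 1 ~ z\<close> show False using far(4)[of 1 5] by (auto dest: sym)
  qed
  have 2: "\<not> (w 2 ~ z \<and> z ~ t)" if "z \<noteq> w 3" "z \<noteq> x" for z
    using full[of "w 2" "w 1" "w 3" s z] that e s n nst far(2)[of 1 3] by (auto dest: sym)
  have 3: "\<not> (s ~ z \<and> z ~ w 4)" if "z \<noteq> w 3" "z \<noteq> x" for z
    using full[of "w 4" "w 5" "w 3" t z] that e t n nst far(2)[of 3 5] by (auto dest: sym)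
  have n': "w 2 \<noteq> w 4" "\<not> w 2 ~ w 4" "x \<noteq> s" "x \<noteq> t" "w 2 \<noteq> x"
    using far(3)[of 2 4] far(2)[of 2 4] sx x by auto
  have "z = w 3 \<or> z = x" if "w 2 ~ z" "z ~ w 4" for z
    using no that by blast
  moreover have "z = w 3 \<or> z = x" if "s ~ z" "z ~ t" for z
    using key that by blast
  ultimately show ?thesis
    using e x s t st n n' nst 2 3 sym by (intro blockI) metis+
qed

lemma block_turning:
  assumes g: "geodesic w 6" and x: "w 3 ~ x" "x \<noteq> w 2" "x \<noteq> w 4" and x5: "x ~ w 5"
    and no: "\<And>t. w 2 ~ t \<Longrightarrow> t ~ w 4 \<Longrightarrow> t = w 3"
    and s: "w 2 ~ s" "s ~ x" "s \<noteq> w 1" "s \<noteq> w 3"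
  shows "block (w 2) s (w 3) x (w 4) (w 5)"
proof -
  note e = geodesic6[OF g] geodesic6[OF g, THEN sym]
  note far = geodesic_facts[OF g]
  have n: "x \<noteq> w 6" "s \<noteq> w 5" "\<not> s ~ w 5" "\<not> s ~ w 4" "\<not> s ~ w 6" "s \<noteq> w 4" "x \<noteq> w 1"
    using far(3)[of 3 6] far(3)[of 2 5] far(4)[of 2 5] far(4)[of 2 6] no s x far(3)[of 2 4] far(3)[of 1 3]
    by (auto dest: sym)
  have X: "z = w 3 \<or> z = s \<or> z = w 5" if "x ~ z" for z
    using full[of x "w 3" s "w 5" z] that s x x5 n far(2)[of 3 5] by (auto dest: sym)
  have F: "z = w 4 \<or> z = x \<or> z = w 6" if "w 5 ~ z" for z
    using full[of "w 5" "w 4" x "w 6" z] that x x5 n e far(2)[of 4 6] by (auto dest: sym)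
  \<comment> \<open>Such a \<open>z\<close> exhausts the neighbours of \<open>s\<close>, so the
    short cycle through \<open>w 1 w 2\<close> must pass through \<open>z\<close>; then
    \<open>w 1\<close> and \<open>w 4\<close> have a common neighbour.\<close>
  have key: False if z: "s ~ z" "z ~ w 4" "z \<noteq> w 3" "z \<noteq> x" for z
  proof -
    have zn: "z \<noteq> w 2" "z \<noteq> w 1" using z far(3)[of 2 4] far(3)[of 1 4] by auto
    have S: "d = w 2 \<or> d = x \<or> d = z" if "s ~ d" for d
      using full[of s "w 2" x z d] that s z zn x by (auto dest: sym)
    have "\<not> w 1 ~ s" using S[of "w 1"] n zn far(2)[of 1 2] by (auto dest: sym)
    moreover have "\<not> w 1 ~ x" using X[of "w 1"] n s far(2)[of 1 3] far(2)[of 1 5] by (auto dest: sym)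
    ultimately have "w 1 ~ z"
      using geodesic_short_left[OF g s(1,3,4) x] S by (metis sym)
    then show False using far(4)[of 1 4] z by auto
  qed
  have 5: "\<not> (s ~ z \<and> z ~ w 5)" if "z \<noteq> w 3" "z \<noteq> x" for z
    using F[of z] that n by (auto dest: sym)
  have s3: "s \<noteq> w 3" "x \<noteq> w 5" using s far(3)[of 3 5] x by auto
  have n': "w 2 \<noteq> w 4" "\<not> w 2 ~ w 4" "w 2 \<noteq> w 5" "\<not> w 2 ~ w 5" "w 2 \<noteq> x" "w 3 \<noteq> w 5"
    using far(3)[of 2 4] far(2)[of 2 4] far(3)[of 2 5] far(2)[of 2 5] far(2)[of 3 5] x by auto
  have "z = w 3 \<or> z = x" if "w 2 ~ z" "z ~ w 4" for z
    using no that by blast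
  moreover have "z = w 3 \<or> z = x" if "w 2 ~ z" "z ~ w 5" for z
    using far(4)[of 2 5] that by auto
  moreover have "z = w 3 \<or> z = x" if "s ~ z" "z ~ w 4" for z
    using key that by blast
  moreover have "z = w 3 \<or> z = x" if "s ~ z" "z ~ w 5" for z
    using 5 that by blast
  ultimately show ?thesis
    using e x x5 s s3 n n' sym by (intro blockI) metis+
qed

text \<open>The cases are governed by whether \<open>w 2\<close> and \<open>w 4\<close> have a
  common neighbour \<open>t\<close> besides \<open>w 3\<close>. If so, one of the edges
  \<open>w 2 w 3\<close>, \<open>w 3 w 4\<close> is the middle rung. If not, the short cycles
  through both edges use \<open>x\<close>, each going straight on or turning to \<open>w 1\<close>
  or \<open>w 5\<close>; turning on both sides would make \<open>x\<close> a common neighbour of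
  \<open>w 1\<close> and \<open>w 5\<close>.\<close>

lemma block_exists:
  assumes g: "geodesic w 6" and x: "w 3 ~ x" "x \<noteq> w 2" "x \<noteq> w 4"
  shows "\<exists>a0 a1 b0 b1 c0 c1. block a0 a1 b0 b1 c0 c1"
proof -
  note e = geodesic6[OF g] geodesic6[OF g, THEN sym]
  note far = geodesic_facts[OF g]
  note gr = geodesic_rev[OF g]
  have nx: "\<not> x ~ w 4" "\<not> x ~ w 2"
    using geodesic_no_triangle[OF g] geodesic_no_triangle[OF gr] x by auto
  show ?thesis
  proof (cases "\<exists>t. w 2 ~ t \<and> t ~ w 4 \<and> t \<noteq> w 3")
    case True
    then obtain t where t: "w 2 ~ t" "t ~ w 4" "t \<noteq> w 3" by blast
    have nt: "\<not> w 1 ~ t" "\<not> w 5 ~ t" "t \<noteq> w 1" "t \<noteq> w 5"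
      using far(4)[of 1 4] far(4)[of 2 5] far(3)[of 1 4] far(3)[of 2 5] t by (auto dest: sym)
    have nn: "\<not> (w 1 ~ z \<and> w 5 ~ z)" for z using far(4)[of 1 5] by (auto dest: sym)
    \<comment> \<open>The one free place at \<open>t\<close> cannot serve the short cycles of both
      sides, so one of them has to use \<open>x\<close>.\<close>
    have T: "z = z'" if "z ~ t" "z' ~ t" "w 1 ~ z" "w 5 ~ z'" "z \<noteq> w 2" "z' \<noteq> w 4" for z z'
      using full[of t "w 2" "w 4" z z'] that t far(3)[of 2 5] far(3)[of 1 4] far(2)[of 2 4]
      by (auto dest: sym)
    have L: "w 1 ~ x \<or> (\<exists>z. w 1 ~ z \<and> z ~ t \<and> z \<noteq> w 2)"
      using geodesic_short_left[OF g t(1) nt(3) t(3) x nt(1)] by metis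
    have R: "w 5 ~ x \<or> (\<exists>z. w 5 ~ z \<and> z ~ t \<and> z \<noteq> w 4)"
      using geodesic_short_left[OF gr, of t x] t nt x by (auto dest: sym)
    show ?thesis
    proof (cases "w 1 ~ x")
      case True
      with R nn obtain z where "w 5 ~ z" "z ~ t" "z \<noteq> w 4" by blast
      then show ?thesis using block_crossing[OF g x t True] by blast
    next
      case False
      with L obtain z where z: "w 1 ~ z" "z ~ t" "z \<noteq> w 2" by blast
      with R T nn have "w 5 ~ x" by metis
      then show ?thesis using block_crossing[OF gr, of x t z] x t z sym[OF t(1)] sym[OF t(2)] by simp blast
    qed
  next
    case False
    then have no: "t = w 3" if "w 2 ~ t" "t ~ w 4" for t using that by blast
    have R: "x ~ w 5 \<or> (\<exists>t. w 4 ~ t \<and> t ~ x \<and> t \<noteq> w 5 \<and> t \<noteq> w 3)"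
    proof -
      obtain r s where 1: "w 3 ~ r" "r \<noteq> w 4" "w 4 ~ s" "s \<noteq> w 3" "r = s \<or> r ~ s"
        by (rule short[of "w 4" "w 3" "w 5" "w 2" x]) (use e x far(2)[of 3 5] far(2)[of 2 4] in \<open>auto dest: sym\<close>)
      have "r = w 2 \<or> r = x" using full[of "w 3" "w 2" "w 4" x r] e x 1 far(2)[of 2 4] by (auto dest: sym)
      then show ?thesis using 1 nx no far(3)[of 2 4] by (auto dest: sym)
    qed
    have L: "x ~ w 1 \<or> (\<exists>t. w 2 ~ t \<and> t ~ x \<and> t \<noteq> w 1 \<and> t \<noteq> w 3)"
    proof -
      obtain r s where 1: "w 3 ~ r" "r \<noteq> w 2" "w 2 ~ s" "s \<noteq> w 3" "r = s \<or> r ~ s"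
        by (rule short[of "w 2" "w 3" "w 1" "w 4" x]) (use e x far(2)[of 1 3] far(2)[of 2 4] in \<open>auto dest: sym\<close>)
      have "r = w 4 \<or> r = x" using full[of "w 3" "w 2" "w 4" x r] e x 1 far(2)[of 2 4] by (auto dest: sym)
      then show ?thesis using 1 nx no far(3)[of 2 4] by (auto dest: sym)
    qed
    have "\<not> (x ~ w 1 \<and> x ~ w 5)" using far(4)[of 1 5] by (auto dest: sym)
    with L R consider (straight) s t where "w 2 ~ s" "s ~ x" "s \<noteq> w 1" "s \<noteq> w 3"
        "w 4 ~ t" "t ~ x" "t \<noteq> w 5" "t \<noteq> w 3"
      | (right) s where "x ~ w 5" "w 2 ~ s" "s ~ x" "s \<noteq> w 1" "s \<noteq> w 3"
      | (left) t where "x ~ w 1" "w 4 ~ t" "t ~ x" "t \<noteq> w 5" "t \<noteq> w 3"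
      by blast
    then show ?thesis
    proof cases
      case straight
      then show ?thesis using block_straight[OF g x no] by blast
    next
      case right
      then show ?thesis using block_turning[OF g x _ no] by blast
    next
      case left
      have "t' = w 3" if "w 4 ~ t'" "t' ~ w 2" for t' using no[of t'] that sym by blast
      then show ?thesis using block_turning[OF gr, of x t] left x by simp blast
    qed
  qed
qed

end

section \<open>Maximal paths and ladders\<close>

text \<open>Coordinates shared by all models: the two-sided ladder on
  \<open>int \<times> bool\<close>. On the layer \<open>False\<close> alone this is adjacency in a
  line.\<close>

definition ladder_adj :: "int \<times> bool \<Rightarrow> int \<times> bool \<Rightarrow> bool" where
  "ladder_adj p q \<longleftrightarrow> snd p = snd q \<and> (fst q = fst p + 1 \<or> fst p = fst q + 1) \<or>
     fst p = fst q \<and> snd p \<noteq> snd q"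

text \<open>Integer intervals, bounded or not, so that one index set covers finite, one-sided and
  two-sided objects.\<close>

definition convex_int :: "int set \<Rightarrow> bool" where
  "convex_int I \<longleftrightarrow> (\<forall>i\<in>I. \<forall>j\<in>I. {i..j} \<subseteq> I)"

lemma convex_intD: "\<lbrakk>convex_int I; i \<in> I; j \<in> I; i \<le> m; m \<le> j\<rbrakk> \<Longrightarrow> m \<in> I"
  unfolding convex_int_def by fastforce

lemma convex_int_le_max: "\<lbrakk>convex_int I; b \<in> I; b + 1 \<notin> I; i \<in> I\<rbrakk> \<Longrightarrow> i \<le> b"
  using convex_intD[of I b i "b + 1"] by force

lemma convex_int_ge_min: "\<lbrakk>convex_int I; a \<in> I; a - 1 \<notin> I; i \<in> I\<rbrakk> \<Longrightarrow> a \<le> i"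
  using convex_intD[of I i a "a - 1"] by force

text \<open>The four shapes lead to the two-sided model, the one-sided model in either orientation,
  and the finite models. The inductions searching for an end start at 0, hence
  \<open>0 \<in> I\<close>.\<close>

lemma convex_int_cases [consumes 2]:
  assumes "convex_int I" "0 \<in> I"
  obtains (UNIV) "I = UNIV"
    | (below) b where "I = {..b}"
    | (above) a where "I = {a..}"
    | (bounded) a b where "I = {a..b}"
proof -
  have up: "\<exists>b. b \<in> I \<and> b + 1 \<notin> I" if "m \<notin> I" "m \<ge> 0" for m
  proof (rule ccontr)
    assume "\<not> ?thesis"
    with \<open>m \<ge> 0\<close> have "m \<in> I" 
      by (induction m rule: int_ge_induct) (use assms(2) in auto)
    with that show False by simp
  qed
  have down: "\<exists>b. b \<in> I \<and> b - 1 \<notin> I" if "m \<notin> I" "m \<le> 0" for m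
  proof (rule ccontr)
    assume "\<not> ?thesis"
    with \<open>m \<le> 0\<close> have "m \<in> I"
      by (induction m rule: int_le_induct) (use assms(2) in auto)
    with that show False by simp
  qed
  have U: "I \<subseteq> {..b}" if "b \<in> I" "b + 1 \<notin> I" for b
    using convex_int_le_max[OF assms(1) that] by auto
  have L: "I \<subseteq> {a..}" if "a \<in> I" "a - 1 \<notin> I" for a
    using convex_int_ge_min[OF assms(1) that] by auto
  have D: "m \<in> I" if "i \<in> I" "j \<in> I" "i \<le> m" "m \<le> j" for i j m
    using convex_intD[OF assms(1) that] .
  show thesis
  proof (cases "\<exists>b. b \<in> I \<and> b + 1 \<notin> I")
    case True
    then obtain b where b: "b \<in> I" "b + 1 \<notin> I" by blast
    show thesis
    proof (cases "\<exists>a. a \<in> I \<and> a - 1 \<notin> I")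
      case True
      then obtain a where a: "a \<in> I" "a - 1 \<notin> I" by blast
      have "I = {a..b}" using U[OF b] L[OF a] D[OF a(1) b(1)] by force
      then show thesis by (rule bounded)
    next
      case False
      have "m \<in> I" if "m \<le> b" for m
        using down[of m] False up[of m] D[OF assms(2) b(1), of m] that by (cases "m \<ge> 0") auto
      then have "I = {..b}" using U[OF b] by auto
      then show thesis by (rule below)
    qed
  next
    case up': False
    then have pos: "m \<in> I" if "m \<ge> 0" for m using up[of m] that by blast
    show thesis
    proof (cases "\<exists>a. a \<in> I \<and> a - 1 \<notin> I")
      case True
      then obtain a where a: "a \<in> I" "a - 1 \<notin> I" by blast
      have "m \<in> I" if "a \<le> m" for m
        using pos[of m] D[OF a(1) assms(2), of m] that by (cases "m \<ge> 0") auto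
      then have "I = {a..}" using L[OF a] by auto
      then show thesis by (rule above)
    next
      case False
      have "m \<in> I" for m using pos[of m] down[of m] False by (cases "m \<ge> 0") auto
      then have "I = UNIV" by auto
      then show thesis by (rule UNIV)
    qed
  qed
qed

context flat_graph
begin

text \<open>Only \<open>K = {False}\<close> (a path) and \<open>K = UNIV\<close> (a ladder with rungs indexed by \<open>I\<close>) are used.\<close>

definition strip :: "bool set \<Rightarrow> int set \<Rightarrow> (int \<times> bool \<Rightarrow> 'a) \<Rightarrow> bool" where
  "strip K I f \<longleftrightarrow> convex_int I \<and> inj_on f (I \<times> K) \<and> f ` (I \<times> K) \<subseteq> verts G \<and>
     (\<forall>p\<in>I \<times> K. \<forall>q\<in>I \<times> K. ladder_adj p q \<longrightarrow> f p ~ f q)"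

text \<open>Extensions keep the old values and the old indices, so a base placed at the indices -1,
  0, 1 stays there.\<close>

definition maximal_strip :: "bool set \<Rightarrow> int set \<Rightarrow> (int \<times> bool \<Rightarrow> 'a) \<Rightarrow> bool" where
  "maximal_strip K I f \<longleftrightarrow> strip K I f \<and>
     (\<forall>I' f'. strip K I' f' \<longrightarrow> I \<subseteq> I' \<longrightarrow> (\<forall>p\<in>I \<times> K. f' p = f p) \<longrightarrow> I' = I)"

text \<open>Zorn's lemma is needed because the extension may go on forever in both
  directions.\<close>

lemma maximal_strip_exists:
  assumes s0: "strip K I0 f0" and K: "K \<noteq> {}"
  obtains I f where "maximal_strip K I f" "I0 \<subseteq> I" "\<And>p. p \<in> I0 \<times> K \<Longrightarrow> f p = f0 p"
proof -
  \<comment> \<open>A strip says nothing about \<open>f\<close> off \<open>I \<times> K\<close>.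
    Passing to the graph of the restriction removes these irrelevant values and turns extension into
    inclusion; \<open>K \<noteq> {}\<close> allows \<open>I\<close> to be recovered from it.\<close>
  define gr where "gr I f = (\<lambda>p. (p, f p)) ` (I \<times> K)" for I :: "int set" and f :: "int \<times> bool \<Rightarrow> 'a"
  define F where "F = {gr I f | I f. strip K I f \<and> I0 \<subseteq> I \<and> (\<forall>p\<in>I0 \<times> K. f p = f0 p)}"
  have "gr I0 f0 \<in> F" unfolding F_def using s0 by blast
  then have "F \<noteq> {}" by blast
  moreover have "\<Union>C \<in> F" if C: "C \<noteq> {}" "subset.chain F C" for C
  proof -
    have "\<forall>X\<in>C. \<exists>I f. X = gr I f \<and> strip K I f \<and> I0 \<subseteq> I \<and> (\<forall>p\<in>I0 \<times> K. f p = f0 p)"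
      using C unfolding subset.chain_def F_def by blast
    then obtain J h where Jh: "\<And>X. X \<in> C \<Longrightarrow> X = gr (J X) (h X) \<and> strip K (J X) (h X) \<and> I0 \<subseteq> J X \<and>
        (\<forall>p\<in>I0 \<times> K. h X p = f0 p)"
      by metis
    define I where "I = (\<Union>X\<in>C. J X)"
    define f where "f p = (SOME u. (p, u) \<in> \<Union>C)" for p
    have total: "X \<subseteq> Y \<or> Y \<subseteq> X" if "X \<in> C" "Y \<in> C" for X Y
      using C that unfolding subset.chain_def by blast
    have mem: "(p, u) \<in> X \<longleftrightarrow> p \<in> J X \<times> K \<and> u = h X p" if "X \<in> C" for X p u
    proof -
      have "X = gr (J X) (h X)" using Jh[OF that] by blast
      then have "(p, u) \<in> X \<longleftrightarrow> (p, u) \<in> gr (J X) (h X)" by (rule arg_cong)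
      then show ?thesis unfolding gr_def by auto
    qed
    have mono: "J X \<subseteq> J Y" if "X \<subseteq> Y" "X \<in> C" "Y \<in> C" for X Y
    proof
      fix i assume "i \<in> J X"
      moreover obtain k where "k \<in> K" using K by blast
      ultimately have "((i, k), h X (i, k)) \<in> X" using mem[OF that(2)] by auto
      then have "((i, k), h X (i, k)) \<in> Y" using that by blast
      then show "i \<in> J Y" using mem[OF that(3)] by auto
    qed
    have f: "f p = h X p" if "X \<in> C" "p \<in> J X \<times> K" for X p
    proof -
      have pX: "(p, h X p) \<in> X" using mem[OF that(1)] that(2) by blast
      then have "(p, f p) \<in> \<Union>C" unfolding f_def using that(1) by (intro someI[of "\<lambda>u. (p, u) \<in> \<Union>C"]) blast
      then obtain Y where Y: "Y \<in> C" "(p, f p) \<in> Y" by blast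
      have single: "u = v" if "Z \<in> C" "(q, u) \<in> Z" "(q, v) \<in> Z" for q u v Z
        using mem[OF that(1)] that(2,3) by simp
      from total[OF that(1) Y(1)] show ?thesis using single pX Y that(1) by blast
    qed
    have pair: "\<exists>X\<in>C. i \<in> J X \<and> j \<in> J X" if ij: "i \<in> I" "j \<in> I" for i j
    proof -
      obtain X Y where "X \<in> C" "i \<in> J X" "Y \<in> C" "j \<in> J Y" using ij unfolding I_def by blast
      with total mono show ?thesis by (metis subsetD)
    qed
    have "strip K I f"
      unfolding strip_def
    proof (intro conjI)
      show "convex_int I"
        unfolding convex_int_def
      proof (intro ballI)
        fix i j assume "i \<in> I" "j \<in> I"
        then obtain X where X: "X \<in> C" "i \<in> J X" "j \<in> J X" using pair by blast
        then have "{i..j} \<subseteq> J X" using Jh[OF X(1)] unfolding strip_def convex_int_def by blast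
        then show "{i..j} \<subseteq> I" using X(1) unfolding I_def by blast
      qed
      show "inj_on f (I \<times> K)"
      proof (rule inj_onI)
        fix p q assume pq: "p \<in> I \<times> K" "q \<in> I \<times> K" "f p = f q"
        then obtain X where X: "X \<in> C" "p \<in> J X \<times> K" "q \<in> J X \<times> K" using pair by force
        then have "h X p = h X q" using f pq by metis
        moreover have "inj_on (h X) (J X \<times> K)" using Jh[OF X(1)] unfolding strip_def by blast
        ultimately show "p = q" using X inj_onD by metis
      qed
      show "f ` (I \<times> K) \<subseteq> verts G"
      proof
        fix u assume "u \<in> f ` (I \<times> K)"
        then obtain p X where "u = f p" "X \<in> C" "p \<in> J X \<times> K" unfolding I_def by auto
        with f Jh show "u \<in> verts G" unfolding strip_def by (metis image_subset_iff)
      qed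
      show "\<forall>p\<in>I \<times> K. \<forall>q\<in>I \<times> K. ladder_adj p q \<longrightarrow> f p ~ f q"
      proof (intro ballI impI)
        fix p q assume pq: "p \<in> I \<times> K" "q \<in> I \<times> K" "ladder_adj p q"
        then obtain X where X: "X \<in> C" "p \<in> J X \<times> K" "q \<in> J X \<times> K" using pair by force
        then show "f p ~ f q" using f Jh pq(3) unfolding strip_def by metis
      qed
    qed
    moreover have "I0 \<subseteq> I" using C Jh unfolding I_def by blast
    moreover have "\<forall>p\<in>I0 \<times> K. f p = f0 p"
    proof
      fix p assume p: "p \<in> I0 \<times> K"
      obtain X where "X \<in> C" using C by blast
      with p Jh[of X] f[of X p] show "f p = f0 p" by auto
    qed
    moreover have "\<Union>C = gr I f"
    proof -
      have "X = (\<lambda>p. (p, f p)) ` (J X \<times> K)" if "X \<in> C" for X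
        using mem[OF that] f[OF that] by force
      then have "\<Union>C = (\<Union>X\<in>C. (\<lambda>p. (p, f p)) ` (J X \<times> K))" by (metis (no_types, lifting) SUP_cong image_ident)
      also have "\<dots> = gr I f" unfolding gr_def I_def by blast
      finally show ?thesis .
    qed
    ultimately show ?thesis unfolding F_def by blast
  qed
  ultimately obtain M where M: "M \<in> F" "\<And>X. X \<in> F \<Longrightarrow> M \<subseteq> X \<Longrightarrow> X = M"
    using subset_Zorn_nonempty[of F] by blast
  then obtain I f where If: "M = gr I f" "strip K I f" "I0 \<subseteq> I" "\<forall>p\<in>I0 \<times> K. f p = f0 p"
    unfolding F_def by blast
  have "I' = I" if "strip K I' f'" "I \<subseteq> I'" "\<forall>p\<in>I \<times> K. f' p = f p" for I' f'
  proof -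
    have "gr I' f' \<in> F" unfolding F_def using that If by fastforce
    moreover have "gr I f \<subseteq> gr I' f'" using that unfolding gr_def by force
    ultimately have "gr I' f' = gr I f" using M If by blast
    then have "fst ` gr I' f' = fst ` gr I f" by simp
    then have "I' \<times> K = I \<times> K" unfolding gr_def by (simp add: image_image)
    then show ?thesis using K by (auto simp: times_eq_iff)
  qed
  then have "maximal_strip K I f" unfolding maximal_strip_def using If by blast
  then show thesis using that If by blast
qed

lemma strip_adj: "\<lbrakk>strip K I f; p \<in> I \<times> K; q \<in> I \<times> K; ladder_adj p q\<rbrakk> \<Longrightarrow> f p ~ f q"
  unfolding strip_def by blast

lemma strip_inj: "\<lbrakk>strip K I f; p \<in> I \<times> K; q \<in> I \<times> K; f p = f q\<rbrakk> \<Longrightarrow> p = q"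
  unfolding strip_def inj_on_def by blast

lemma strip_verts: "\<lbrakk>strip K I f; p \<in> I \<times> K\<rbrakk> \<Longrightarrow> f p \<in> verts G"
  unfolding strip_def by blast

lemma strip_convex: "strip K I f \<Longrightarrow> convex_int I"
  unfolding strip_def by blast

text \<open>Saturation: an interior vertex has two neighbours along the strip and
  \<open>card K - 1\<close> across it, which already is the maximal degree
  \<open>card K + 1\<close>. This bound is 2 for paths and 3 for ladders.\<close>

lemma strip_interior:
  assumes s: "strip K I f" and deg: "\<And>u. u \<in> verts G \<Longrightarrow> card (nbrs G u) \<le> card K + 1"
    and i: "i - 1 \<in> I" "i + 1 \<in> I" "k \<in> K" and v: "f (i, k) ~ v"
  obtains q where "q \<in> I \<times> K" "ladder_adj (i, k) q" "v = f q"
proof -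
  let ?Q = "{(i - 1, k), (i + 1, k)} \<union> {i} \<times> (K - {k})"
  have iI: "i \<in> I" using convex_intD[OF strip_convex[OF s] i(1,2)] by simp
  have Q: "?Q \<subseteq> I \<times> K" "\<And>q. q \<in> ?Q \<Longrightarrow> ladder_adj (i, k) q" using i iI by (auto simp: ladder_adj_def)
  have finK: "finite K" by simp
  have "card ?Q = 2 + (card K - 1)"
    using i finK by (subst card_Un_disjoint) (auto simp: card_cartesian_product)
  moreover have "card K > 0" using i finK by (auto simp: card_gt_0_iff)
  ultimately have "card ?Q = card K + 1" by simp
  moreover have "inj_on f ?Q" using s Q(1) unfolding strip_def by (meson inj_on_subset)
  ultimately have cQ: "card (f ` ?Q) = card K + 1" by (simp add: card_image)
  have V: "f (i, k) \<in> verts G" using v adj_verts by blast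
  have sub: "f ` ?Q \<subseteq> nbrs G (f (i, k))"
    using strip_adj[OF s, of "(i, k)"] Q iI i unfolding nbrs_def adj_def by blast
  have "f ` ?Q = nbrs G (f (i, k))"
    using card_seteq[OF _ sub] card_nbrs[OF V] deg[OF V] cQ by simp
  then have "v \<in> f ` ?Q" using v unfolding nbrs_def adj_def by blast
  then obtain q where "q \<in> ?Q" "v = f q" by blast
  then show thesis using that[of q] Q by blast
qed

text \<open>Interior vertices are saturated, so an additional edge can only join the two ends; in
  particular a strip with such an edge is bounded.\<close>

lemma strip_chord_ends:
  assumes s: "strip K I f" and deg: "\<And>u. u \<in> verts G \<Longrightarrow> card (nbrs G u) \<le> card K + 1"
    and pq: "(i, k) \<in> I \<times> K" "(j, l) \<in> I \<times> K" "f (i, k) ~ f (j, l)" "\<not> ladder_adj (i, k) (j, l)"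
    and "i \<le> j"
  shows "i < j" "I = {i..j}"
proof -
  show "i < j"
    using pq irrefl \<open>i \<le> j\<close> by (cases "k = l") (auto simp: ladder_adj_def le_less)
  note conv = strip_convex[OF s]
  have I: "i + 1 \<in> I" "j - 1 \<in> I"
    using convex_intD[OF conv, of i j "i + 1"] convex_intD[OF conv, of i j "j - 1"] pq \<open>i < j\<close> by auto
  have "i - 1 \<notin> I"
  proof
    assume "i - 1 \<in> I"
    then obtain q where "q \<in> I \<times> K" "ladder_adj (i, k) q" "f (j, l) = f q"
      using strip_interior[OF s deg, of i k "f (j, l)"] I pq by blast
    then show False using strip_inj[OF s] pq by metis
  qed
  moreover have "j + 1 \<notin> I"
  proof
    assume "j + 1 \<in> I"
    then obtain q where q: "q \<in> I \<times> K" "ladder_adj (j, l) q" "f (i, k) = f q"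
      using strip_interior[OF s deg, of j l "f (i, k)"] I pq sym by blast
    then have "ladder_adj (j, l) (i, k)" using strip_inj[OF s] pq by metis
    then show False using pq unfolding ladder_adj_def by auto
  qed
  ultimately have "i \<le> m \<and> m \<le> j" if "m \<in> I" for m
    using convex_int_ge_min[OF conv, of i m] convex_int_le_max[OF conv, of j m] pq that by auto
  moreover have "m \<in> I" if "i \<le> m \<and> m \<le> j" for m
    using convex_intD[OF conv, of i j m] pq that by blast
  ultimately show "I = {i..j}" by (intro set_eqI) (metis atLeastAtMost_iff)
qed

text \<open>A strip need not be induced, so \<open>h\<close> may have further edges into it: only
  the edges to the last rung and within the new one matter.\<close>

lemma strip_extend:
  assumes s: "strip K I f" and b: "b \<in> I" "b + 1 \<notin> I"
    and h: "inj_on h K" "h ` K \<inter> f ` (I \<times> K) = {}" "\<And>k. k \<in> K \<Longrightarrow> f (b, k) ~ h k"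
      "\<And>k l. k \<in> K \<Longrightarrow> l \<in> K \<Longrightarrow> k \<noteq> l \<Longrightarrow> h k ~ h l"
  shows "\<not> maximal_strip K I f"
proof
  assume m: "maximal_strip K I f"
  let ?I = "insert (b + 1) I"
  let ?f = "\<lambda>(i, k). if i = b + 1 then h k else f (i, k)"
  note conv = strip_convex[OF s]
  have le: "i \<le> b" if "i \<in> I" for i using convex_int_le_max[OF conv b that] .
  have "strip K ?I ?f"
    unfolding strip_def
  proof (intro conjI)
    have "m \<in> ?I" if "i \<in> ?I" "j \<in> ?I" "i \<le> m" "m \<le> j" for i j m
    proof (cases "m = b + 1")
      case False
      with that le[of i] le[of j] have "m \<le> b" by auto
      with that have "i \<in> I" by auto
      then show ?thesis using convex_intD[OF conv _ b(1)] that \<open>m \<le> b\<close> by blast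
    qed simp
    then show "convex_int ?I" unfolding convex_int_def by (meson atLeastAtMost_iff subsetI)
    show "inj_on ?f (?I \<times> K)"
    proof (rule inj_onI)
      fix p q assume *: "p \<in> ?I \<times> K" "q \<in> ?I \<times> K" "?f p = ?f q"
      obtain i k j l where ij: "p = (i, k)" "q = (j, l)" by (cases p, cases q)
      have pq: "i \<in> ?I" "k \<in> K" "j \<in> ?I" "l \<in> K" "?f (i, k) = ?f (j, l)"
        using * unfolding ij by blast+
      have "h k \<noteq> f (j, l)" if "k \<in> K" "j \<in> I" "l \<in> K" for k j l using h(2) that by blast
      then have "i = b + 1 \<longleftrightarrow> j = b + 1" using pq by (auto split: if_splits dest: HOL.sym)
      then show "p = q"
        unfolding ij using pq h(1) strip_inj[OF s, of "(i, k)" "(j, l)"] by (auto split: if_splits dest: inj_onD)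
    qed
    have "h k \<in> verts G" if "k \<in> K" for k using h(3)[OF that] adj_verts by blast
    then show "?f ` (?I \<times> K) \<subseteq> verts G" using strip_verts[OF s] by auto
    have *: "?f (i, k) ~ ?f (j, l)"
      if "i \<in> ?I" "k \<in> K" "j \<in> ?I" "l \<in> K" "ladder_adj (i, k) (j, l)" "i \<le> j" for i k j l
    proof (cases "j = b + 1")
      case True
      then show ?thesis using that h(3,4) by (auto simp: ladder_adj_def)
    next
      case False
      then show ?thesis using that strip_adj[OF s, of "(i, k)" "(j, l)"] le[of j] by auto
    qed
    show "\<forall>p\<in>?I \<times> K. \<forall>q\<in>?I \<times> K. ladder_adj p q \<longrightarrow> ?f p ~ ?f q"
    proof (intro ballI impI)
      fix p q assume pq: "p \<in> ?I \<times> K" "q \<in> ?I \<times> K" "ladder_adj p q"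
      obtain i k j l where ij: "p = (i, k)" "q = (j, l)" by (cases p, cases q)
      have "ladder_adj q p" using pq(3) unfolding ladder_adj_def by auto
      then show "?f p ~ ?f q"
        using *[of i k j l] sym[OF *[of j l i k]] pq unfolding ij by (cases "i \<le> j") auto
    qed
  qed
  moreover have "\<forall>p\<in>I \<times> K. ?f p = f p" using b by auto
  ultimately have "?I = I" using m unfolding maximal_strip_def by blast
  then show False using b by blast
qed

text \<open>Reflection at 0 fixes the base indices -1, 0, 1 as a set, so statements about right ends
  carry over to left ends.\<close>

lemma strip_reflect:
  assumes "strip K I f"
  shows "strip K (uminus ` I) (\<lambda>(i, k). f (- i, k))"
  unfolding strip_def
proof (intro conjI)
  show "convex_int (uminus ` I)"
    unfolding convex_int_def
  proof (clarsimp simp: subset_iff)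
    fix i j t assume "i \<in> I" "j \<in> I" "- i \<le> t" "t \<le> - j"
    then have "- t \<in> I" using convex_intD[OF strip_convex[OF assms], of j i "- t"] by simp
    then show "t \<in> uminus ` I" by force
  qed
  show "inj_on (\<lambda>(i, k). f (- i, k)) (uminus ` I \<times> K)"
    using strip_inj[OF assms] by (force simp: inj_on_def)
  show "(\<lambda>(i, k). f (- i, k)) ` (uminus ` I \<times> K) \<subseteq> verts G"
    using assms unfolding strip_def by force
  show "\<forall>p\<in>uminus ` I \<times> K. \<forall>q\<in>uminus ` I \<times> K. ladder_adj p q \<longrightarrow>
      (case p of (i, k) \<Rightarrow> f (- i, k)) ~ (case q of (i, k) \<Rightarrow> f (- i, k))"
    using strip_adj[OF assms] by (force simp: ladder_adj_def)
qed

lemma maximal_strip_reflect: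
  assumes "maximal_strip K I f"
  shows "maximal_strip K (uminus ` I) (\<lambda>(i, k). f (- i, k))"
  unfolding maximal_strip_def
proof (intro conjI allI impI)
  show "strip K (uminus ` I) (\<lambda>(i, k). f (- i, k))"
    using assms strip_reflect unfolding maximal_strip_def by blast
  fix I' f' assume *: "strip K I' f'" "uminus ` I \<subseteq> I'"
    "\<forall>p\<in>uminus ` I \<times> K. f' p = (\<lambda>(i, k). f (- i, k)) p"
  have "strip K (uminus ` I') (\<lambda>(i, k). f' (- i, k))" using strip_reflect *(1) .
  moreover have "I \<subseteq> uminus ` I'" using *(2) by force
  moreover have "\<forall>p\<in>I \<times> K. (\<lambda>(i, k). f' (- i, k)) p = f p" using *(3) by force
  ultimately have "uminus ` I' = I" using assms unfolding maximal_strip_def by blast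
  then show "I' = uminus ` I" by force
qed

end

section \<open>Model graphs as induced subgraphs\<close>

text \<open>The map goes from the model into \<open>G\<close>, opposite to
  \<open>graph_isomorphic\<close>, so that it can be extended when the model is enlarged by
  \<open>modify_end\<close>.\<close>

definition embeds :: "'b graph \<Rightarrow> 'a graph \<Rightarrow> ('b \<Rightarrow> 'a) \<Rightarrow> bool" where
  "embeds H G g \<longleftrightarrow> inj_on g (verts H) \<and> g ` verts H \<subseteq> verts G \<and>
     (\<forall>u\<in>verts H. \<forall>v\<in>verts H. (u, v) \<in> edges H \<longleftrightarrow> (g u, g v) \<in> edges G)"

lemma mem_path_graph [simp]:
  "verts (path_graph n) = {..<n}"
  "(i, j) \<in> edges (path_graph n) \<longleftrightarrow> i < n \<and> j < n \<and> (j = Suc i \<or> i = Suc j)"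
  by (auto simp: path_graph_def)

lemma mem_cycle_graph [simp]:
  "verts (cycle_graph n) = {..<n}"
  "(i, j) \<in> edges (cycle_graph n) \<longleftrightarrow> i < n \<and> j < n \<and> (j = Suc i mod n \<or> i = Suc j mod n)"
  by (auto simp: cycle_graph_def)

lemma mem_both_side_line [simp]:
  "verts both_side_line = UNIV"
  "(i, j) \<in> edges both_side_line \<longleftrightarrow> j = i + 1 \<or> i = j + 1"
  by (auto simp: both_side_line_def)

lemma mem_one_side_line [simp]:
  "verts one_side_line = UNIV"
  "(i, j) \<in> edges one_side_line \<longleftrightarrow> j = Suc i \<or> i = Suc j"
  by (auto simp: one_side_line_def)

lemma mem_product_K2 [simp]:
  "verts (cartesian_product H K2) = verts H \<times> UNIV"
  "((a, b), (c, d)) \<in> edges (cartesian_product H K2) \<longleftrightarrow>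
     a = c \<and> a \<in> verts H \<and> b \<noteq> d \<or> (a, c) \<in> edges H \<and> b = d"
  by (auto simp: cartesian_product_def K2_def)

lemma mem_moebius_ladder [simp]:
  "verts (moebius_ladder n) = {..<2 * n}"
  "(i, j) \<in> edges (moebius_ladder n) \<longleftrightarrow>
     i < 2 * n \<and> j < 2 * n \<and> (j = Suc i mod (2 * n) \<or> i = Suc j mod (2 * n) \<or> j = i + n \<or> i = j + n)"
  by (auto simp: moebius_ladder_def)

lemma Suc_mod_if: "s < n \<Longrightarrow> Suc s mod n = (if Suc s = n then 0 else Suc s)"
  by auto

context flat_graph
begin

lemma closed_subset_all:
  assumes "S \<noteq> {}" "S \<subseteq> verts G" "\<And>u v. u \<in> S \<Longrightarrow> u ~ v \<Longrightarrow> v \<in> S"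
  shows "S = verts G"
proof -
  obtain u where u: "u \<in> S" using assms by blast
  have "v \<in> S" if "(u, v) \<in> (edges G)\<^sup>*" for v
    using that by induction (use u assms(3) in \<open>auto simp: adj_def\<close>)
  then show ?thesis using conn u assms(2) unfolding connected_graph_def by blast
qed

text \<open>Surjectivity is obtained from connectedness: an image closed under neighbours is
  everything. Only local information at the vertices of the model is needed.\<close>

lemma embeds_iso:
  assumes g: "embeds H G g" and ne: "verts H \<noteq> {}"
    and closed: "\<And>u v. u \<in> verts H \<Longrightarrow> g u ~ v \<Longrightarrow> v \<in> g ` verts H"
  shows "graph_isomorphic G H"
proof -
  have "g ` verts H = verts G"
    by (rule closed_subset_all) (use assms in \<open>auto simp: embeds_def\<close>)
  then have b: "bij_betw g (verts H) (verts G)" using g unfolding embeds_def bij_betw_def by blast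
  let ?h = "inv_into (verts H) g"
  have "bij_betw ?h (verts G) (verts H)" using b by (rule bij_betw_inv_into)
  moreover have "(u, v) \<in> edges G \<longleftrightarrow> (?h u, ?h v) \<in> edges H" if "u \<in> verts G" "v \<in> verts G" for u v
  proof -
    have "g (?h u) = u" "g (?h v) = v" using b that by (auto simp: bij_betw_inv_into_right)
    moreover have "?h u \<in> verts H" "?h v \<in> verts H"
      using that \<open>bij_betw ?h _ _\<close> by (auto dest: bij_betwE)
    ultimately show ?thesis using g unfolding embeds_def by metis
  qed
  ultimately show ?thesis unfolding graph_isomorphic_def by blast
qed

text \<open>States that a strip is induced. By \<open>strip_chord_ends\<close> this fails only if
  the two ends are joined, so it separates open strips from closed ones.\<close>

definition chordless :: "bool set \<Rightarrow> int set \<Rightarrow> (int \<times> bool \<Rightarrow> 'a) \<Rightarrow> bool" where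
  "chordless K I f \<longleftrightarrow> (\<forall>p\<in>I \<times> K. \<forall>q\<in>I \<times> K. f p ~ f q \<longrightarrow> ladder_adj p q)"

lemma strip_embeds:
  assumes "strip K I f" "chordless K I f" "inj_on h (verts H)" "h ` verts H \<subseteq> I \<times> K"
    and "\<And>u v. u \<in> verts H \<Longrightarrow> v \<in> verts H \<Longrightarrow> (u, v) \<in> edges H \<longleftrightarrow> ladder_adj (h u) (h v)"
  shows "embeds H G (f \<circ> h)"
proof -
  have h: "h u \<in> I \<times> K" if "u \<in> verts H" for u using assms(4) that by blast
  have "f (h u) ~ f (h v) \<longleftrightarrow> ladder_adj (h u) (h v)" if "u \<in> verts H" "v \<in> verts H" for u v
    using strip_adj[OF assms(1)] assms(2) h that unfolding chordless_def by blast
  moreover have "inj_on (f \<circ> h) (verts H)"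
    using assms(1,3,4) unfolding strip_def by (meson comp_inj_on inj_on_subset)
  moreover have "(f \<circ> h) ` verts H \<subseteq> verts G"
    using strip_verts[OF assms(1) h] by auto
  ultimately show ?thesis using assms(5) unfolding embeds_def adj_def by simp
qed

section \<open>Paths, cycles and lines\<close>

text \<open>For a path any outside neighbour of an end is a legitimate next vertex, so maximality
  alone closes the ends; for ladders it does not, whence the end modifications.\<close>

lemma path_end_closed:
  assumes m: "maximal_strip {False} I f" and i: "i \<in> I" "i + 1 \<notin> I" and v: "f (i, False) ~ v"
  shows "v \<in> f ` (I \<times> {False})"
proof (rule ccontr)
  assume "v \<notin> f ` (I \<times> {False})"
  moreover have "strip {False} I f" using m unfolding maximal_strip_def by blast
  ultimately show False using strip_extend[of "{False}" I f i "\<lambda>_. v"] i v m by auto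
qed

lemma path_start_closed:
  assumes m: "maximal_strip {False} I f" and i: "i \<in> I" "i - 1 \<notin> I" and v: "f (i, False) ~ v"
  shows "v \<in> f ` (I \<times> {False})"
proof -
  have "- i + 1 \<notin> uminus ` I"
  proof
    assume "- i + 1 \<in> uminus ` I"
    then obtain t where "t \<in> I" "- i + 1 = - t" by blast
    moreover from this have "t = i - 1" by simp
    ultimately show False using i by simp
  qed
  then have "v \<in> (\<lambda>(i, k). f (- i, k)) ` (uminus ` I \<times> {False})"
    using path_end_closed[OF maximal_strip_reflect[OF m], of "- i"] i v by simp
  then show ?thesis by force
qed

lemma path_classification:
  assumes m: "maximal_strip {False} I f" and I: "{-1, 0, 1} \<subseteq> I"
    and deg: "\<And>u. u \<in> verts G \<Longrightarrow> card (nbrs G u) \<le> 2"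
  shows "(\<exists>n\<ge>1. graph_isomorphic G (path_graph n)) \<or>
    (\<exists>n\<ge>3. graph_isomorphic G (cycle_graph n)) \<or>
    graph_isomorphic G both_side_line \<or> graph_isomorphic G one_side_line"
proof -
  have s: "strip {False} I f" using m unfolding maximal_strip_def by blast
  have deg': "card (nbrs G u) \<le> card {False} + 1" if "u \<in> verts G" for u using deg[OF that] by simp
  have closed: "v \<in> f ` (I \<times> {False})" if "p \<in> I \<times> {False}" "f p ~ v" for p v
  proof -
    obtain i where p: "p = (i, False)" "i \<in> I" using \<open>p \<in> _\<close> by blast
    show ?thesis
    proof (cases "i + 1 \<in> I \<and> i - 1 \<in> I")
      case True
      then show ?thesis using strip_interior[OF s deg', of i False v] that p by blast
    next
      case False
      then show ?thesis using path_end_closed[OF m] path_start_closed[OF m] that p by blast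
    qed
  qed
  have iso: "graph_isomorphic G H"
    if "chordless {False} I f" "inj_on h (verts H)" "h ` verts H = I \<times> {False}"
      "\<And>u v. u \<in> verts H \<Longrightarrow> v \<in> verts H \<Longrightarrow> (u, v) \<in> edges H \<longleftrightarrow> ladder_adj (h u) (h v)"
    for h and H :: "'b graph"
  proof (rule embeds_iso)
    show "embeds H G (f \<circ> h)" using strip_embeds[OF s] that by blast
    show "verts H \<noteq> {}" using that(3) I by force
    show "v \<in> (f \<circ> h) ` verts H" if "u \<in> verts H" "(f \<circ> h) u ~ v" for u v
    proof -
      have "h u \<in> I \<times> {False}" using that \<open>h ` _ = _\<close> by blast
      then have "v \<in> f ` (h ` verts H)" unfolding \<open>h ` _ = _\<close> using closed that by simp
      then show ?thesis by (simp add: image_comp)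
    qed
  qed
  show ?thesis
  proof (cases "chordless {False} I f")
    case c: True
    have "convex_int I" "0 \<in> I" using strip_convex[OF s] I by auto
    then show ?thesis
    proof (cases rule: convex_int_cases)
      case UNIV
      have "graph_isomorphic G both_side_line"
        by (rule iso[OF c, of "\<lambda>i. (i, False)"]) (auto simp: UNIV inj_on_def ladder_adj_def)
      then show ?thesis by blast
    next
      case (below b)
      have "graph_isomorphic G one_side_line"
      proof (rule iso[OF c, of "\<lambda>n. (b - int n, False)"])
        have "(i, False) \<in> range (\<lambda>n. (b - int n, False))" if "i \<le> b" for i
          using that by (intro image_eqI[of _ _ "nat (b - i)"]) auto
        then show "(\<lambda>n. (b - int n, False)) ` verts one_side_line = I \<times> {False}" using below by auto
      qed (auto simp: inj_on_def ladder_adj_def)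
      then show ?thesis by blast
    next
      case (above a)
      have "graph_isomorphic G one_side_line"
      proof (rule iso[OF c, of "\<lambda>n. (a + int n, False)"])
        have "(i, False) \<in> range (\<lambda>n. (a + int n, False))" if "a \<le> i" for i
          using that by (intro image_eqI[of _ _ "nat (i - a)"]) auto
        then show "(\<lambda>n. (a + int n, False)) ` verts one_side_line = I \<times> {False}" using above by auto
      qed (auto simp: inj_on_def ladder_adj_def)
      then show ?thesis by blast
    next
      case (bounded a b)
      have "graph_isomorphic G (path_graph (nat (b - a + 1)))"
      proof (rule iso[OF c, of "\<lambda>n. (a + int n, False)"])
        have "(i, False) \<in> (\<lambda>n. (a + int n, False)) ` {..<nat (b - a + 1)}" if "a \<le> i" "i \<le> b" for i
          using that by (intro image_eqI[of _ _ "nat (i - a)"]) auto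
        then show "(\<lambda>n. (a + int n, False)) ` verts (path_graph (nat (b - a + 1))) = I \<times> {False}"
          using bounded by auto
      qed (auto simp: inj_on_def ladder_adj_def)
      moreover have "nat (b - a + 1) \<ge> 1" using bounded I by auto
      ultimately show ?thesis by blast
    qed
  next
    case False
    then obtain i' j' where ij': "(i', False) \<in> I \<times> {False}" "(j', False) \<in> I \<times> {False}"
        "f (i', False) ~ f (j', False)" "\<not> ladder_adj (i', False) (j', False)"
      unfolding chordless_def by blast
    define i j where "i = min i' j'" and "j = max i' j'"
    have ij: "(i, False) \<in> I \<times> {False}" "(j, False) \<in> I \<times> {False}"
        "f (i, False) ~ f (j, False)" "\<not> ladder_adj (i, False) (j, False)" "i \<le> j"
      using ij' sym unfolding i_def j_def ladder_adj_def min_def max_def by auto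
    note ends = strip_chord_ends[OF s deg' ij]
    \<comment> \<open>A chord determines the index interval as the one between its ends, so all
      chords join the same two vertices.\<close>
    have wrap: "a = i \<and> b = j" if "a \<in> I" "b \<in> I" "a \<le> b" "f (a, False) ~ f (b, False)" "b \<noteq> a + 1" for a b
    proof -
      have "\<not> ladder_adj (a, False) (b, False)" using that by (auto simp: ladder_adj_def)
      from strip_chord_ends[OF s deg' _ _ that(4) this] that ends show ?thesis by auto
    qed
    define n where "n = nat (j - i + 1)"
    have j: "j \<ge> i + 2" using ends(1) ij(4) unfolding ladder_adj_def by auto
    then have n: "n \<ge> 3" "j = i + int n - 1" unfolding n_def by auto
    have mem: "i + int t \<in> I" if "t < n" for t using that ends(2) n by auto
    have cyc: "f (i + int a, False) ~ f (i + int b, False) \<longleftrightarrow>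
        b = Suc a mod n \<or> a = Suc b mod n" if "a < n" "b < n" "a \<le> b" for a b
    proof
      assume "f (i + int a, False) ~ f (i + int b, False)"
      then have "b = Suc a \<or> (a = 0 \<and> b = n - 1)"
        using wrap[of "i + int a" "i + int b"] mem that n by auto
      then show "b = Suc a mod n \<or> a = Suc b mod n" using that by auto
    next
      assume "b = Suc a mod n \<or> a = Suc b mod n"
      then have "b = Suc a \<or> (a = 0 \<and> b = n - 1)"
        using that n by (auto simp: Suc_mod_if split: if_splits)
      then show "f (i + int a, False) ~ f (i + int b, False)"
        using ij(3) n strip_adj[OF s, of "(i + int a, False)" "(i + int b, False)"] mem that
        by (auto simp: ladder_adj_def algebra_simps of_nat_diff)
    qed
    have "graph_isomorphic G (cycle_graph n)"
    proof (rule embeds_iso)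
      let ?g = "\<lambda>t. f (i + int t, False)"
      have "(a, b) \<in> edges (cycle_graph n) \<longleftrightarrow> ?g a ~ ?g b" if "a < n" "b < n" for a b
        using cyc[of a b] cyc[of b a] sym that by (cases "a \<le> b") auto
      moreover have "inj_on ?g {..<n}"
        using strip_inj[OF s, of "(i + int _, False)" "(i + int _, False)"] mem by (auto simp: inj_on_def)
      moreover have "?g ` {..<n} \<subseteq> verts G" using strip_verts[OF s] mem by auto
      ultimately show "embeds (cycle_graph n) G ?g"
        unfolding embeds_def adj_def by simp
      have "I \<times> {False} = (\<lambda>t. (i + int t, False)) ` {..<n}"
      proof -
        have "(t, False) \<in> (\<lambda>t. (i + int t, False)) ` {..<n}" if "t \<in> I" for t
          using that ends(2) n by (intro image_eqI[of _ _ "nat (t - i)"]) auto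
        then show ?thesis using mem by auto
      qed
      then have "f ` (I \<times> {False}) = ?g ` {..<n}" by (simp add: image_image)
      then show "v \<in> ?g ` verts (cycle_graph n)" if "u \<in> verts (cycle_graph n)" "?g u ~ v" for u v
        using closed[of "(i + int u, False)" v] that mem by auto
      show "verts (cycle_graph n) \<noteq> {}" using n by (auto simp: lessThan_empty_iff)
    qed
    then show ?thesis using n by blast
  qed
qed

section \<open>Maximal ladders and their chords\<close>

text \<open>Rungs -1, 0, 1 are the rungs of a \<open>block\<close>, and the last conjunct is its
  separation condition, remembered while the ladder grows around it.\<close>

definition maximal_ladder :: "int set \<Rightarrow> (int \<times> bool \<Rightarrow> 'a) \<Rightarrow> bool" where
  "maximal_ladder I f \<longleftrightarrow> maximal_strip UNIV I f \<and> {-1, 0, 1} \<subseteq> I \<and>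
     (\<forall>k l. \<not> f (-1, k) ~ f (1, l) \<and>
       (\<forall>z. f (-1, k) ~ z \<longrightarrow> z ~ f (1, l) \<longrightarrow> z = f (0, False) \<or> z = f (0, True)))"

lemma maximal_ladder_reflect:
  assumes "maximal_ladder I f"
  shows "maximal_ladder (uminus ` I) (\<lambda>(i, k). f (- i, k))"
proof -
  have "{-1, 0, 1} \<subseteq> uminus ` I"
    using assms unfolding maximal_ladder_def by force
  moreover have "\<not> f (1, k) ~ f (-1, l)" for k l
    using assms sym unfolding maximal_ladder_def by blast
  moreover have "z = f (0, False) \<or> z = f (0, True)" if "f (1, k) ~ z" "z ~ f (-1, l)" for k l z
    using assms that sym unfolding maximal_ladder_def by blast
  ultimately show ?thesis
    using assms maximal_strip_reflect unfolding maximal_ladder_def by simp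
qed

lemma maximal_ladder_exists:
  assumes "block a0 a1 b0 b1 c0 c1"
  obtains I f where "maximal_ladder I f"
proof -
  let ?f = "\<lambda>(i, k). if i = -1 then (if k then a1 else a0) else if i = 0 then (if k then b1 else b0)
    else (if k then c1 else c0)"
  note b = assms[unfolded block_def]
  have b': "a1 ~ a0" "b1 ~ b0" "c1 ~ c0" "b0 ~ a0" "b1 ~ a1" "c0 ~ b0" "c1 ~ b1"
    using b sym by blast+
  have d: "distinct [a0, a1, b0, b1, c0, c1]" using b irrefl by auto
  have "strip UNIV {-1, 0, 1} ?f"
    unfolding strip_def
  proof (intro conjI)
    show "convex_int {-1, 0, 1}" unfolding convex_int_def by auto
    show "inj_on ?f ({-1, 0, 1} \<times> UNIV)" using d by (auto simp: inj_on_def)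
    show "?f ` ({-1, 0, 1} \<times> UNIV) \<subseteq> verts G" using b adj_verts by auto
    show "\<forall>p\<in>{-1, 0, 1} \<times> UNIV. \<forall>q\<in>{-1, 0, 1} \<times> UNIV. ladder_adj p q \<longrightarrow> ?f p ~ ?f q"
      using b b' by (auto simp: ladder_adj_def)
  qed
  then obtain I f where m: "maximal_strip UNIV I f" "{-1, 0, 1} \<subseteq> I"
      and f: "\<And>p. p \<in> {-1, 0, 1} \<times> UNIV \<Longrightarrow> f p = ?f p"
    by (rule maximal_strip_exists) auto
  have f': "f (-1, k) = (if k then a1 else a0)" "f (0, k) = (if k then b1 else b0)"
    "f (1, k) = (if k then c1 else c0)" for k
    using f by auto
  have "maximal_ladder I f"
    unfolding maximal_ladder_def f' using m b by simp
  then show thesis by (rule that)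
qed

lemma deg_ladder: "u \<in> verts G \<Longrightarrow> card (nbrs G u) \<le> card (UNIV :: bool set) + 1"
  using card_nbrs by simp

context
  fixes I and f :: "int \<times> bool \<Rightarrow> 'a"
  assumes ml: "maximal_ladder I f"
begin

lemma maximal: "maximal_strip UNIV I f" and base: "{-1, 0, 1} \<subseteq> I"
  and no_short_chord: "\<not> f (-1, k) ~ f (1, l)"
  and no_short_detour: "f (-1, k) ~ z \<Longrightarrow> z ~ f (1, l) \<Longrightarrow> z = f (0, False) \<or> z = f (0, True)"
  using ml unfolding maximal_ladder_def by auto

lemma strip: "strip UNIV I f"
  using maximal unfolding maximal_strip_def by blast

lemma conv: "convex_int I"
  using strip by (rule strip_convex)

lemma rung_adj: "i \<in> I \<Longrightarrow> f (i, k) ~ f (i, \<not> k)"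
  using strip_adj[OF strip] by (simp add: ladder_adj_def)

lemma side_adj: "i \<in> I \<Longrightarrow> i + 1 \<in> I \<Longrightarrow> f (i, k) ~ f (i + 1, k)"
  using strip_adj[OF strip] by (simp add: ladder_adj_def)

lemma ladder_inj: "i \<in> I \<Longrightarrow> j \<in> I \<Longrightarrow> f (i, k) = f (j, l) \<longleftrightarrow> i = j \<and> k = l"
  using strip_inj[OF strip, of "(i, k)" "(j, l)"] by auto

lemma interior:
  assumes "i - 1 \<in> I" "i + 1 \<in> I" "f (i, k) ~ v"
  shows "v = f (i - 1, k) \<or> v = f (i + 1, k) \<or> v = f (i, \<not> k)"
proof -
  obtain q where "q \<in> I \<times> UNIV" "ladder_adj (i, k) q" "v = f q"
    by (rule strip_interior[OF strip deg_ladder assms(1,2) _ assms(3)]) auto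
  then show ?thesis by (cases q) (auto simp: ladder_adj_def)
qed

lemma chord_ends:
  assumes "i \<in> I" "j \<in> I" "i \<le> j" "f (i, k) ~ f (j, l)" "\<not> ladder_adj (i, k) (j, l)"
  shows "i < j" "I = {i..j}"
  using strip_chord_ends[OF strip deg_ladder _ _ assms(4,5,3)] assms by auto

text \<open>One chord between the ends forces the parallel one, by its short cycle. The bit
  \<open>s\<close> records whether the closing exchanges the two sides, \<open>k \<noteq> s\<close>
  being exclusive or.\<close>

lemma ladder_closes:
  assumes ch: "\<not> chordless UNIV I f"
  obtains i j s where "I = {i..j}" "i + 3 \<le> j"
    "\<forall>a\<in>I. \<forall>b\<in>I. \<forall>k l. a \<le> b \<longrightarrow>
       (f (a, k) ~ f (b, l) \<longleftrightarrow> ladder_adj (a, k) (b, l) \<or> a = i \<and> b = j \<and> (l = (k \<noteq> s)))"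
    "\<forall>a\<in>I. \<forall>k v. f (a, k) ~ v \<longrightarrow> v \<in> f ` (I \<times> UNIV)"
proof -
  obtain i k j l where ij: "i \<in> I" "j \<in> I" "i \<le> j" "f (i, k) ~ f (j, l)" "\<not> ladder_adj (i, k) (j, l)"
  proof -
    obtain i k j l where "i \<in> I" "j \<in> I" "f (i, k) ~ f (j, l)" "\<not> ladder_adj (i, k) (j, l)"
      using ch unfolding chordless_def by auto
    then show thesis using that[of i j k l] that[of j i l k] sym
      by (cases "i \<le> j") (auto simp: ladder_adj_def)
  qed
  note I = chord_ends(2)[OF ij]
  have mem: "a \<in> I \<longleftrightarrow> i \<le> a \<and> a \<le> j" for a using I by auto
  have b: "i \<le> -1" "1 \<le> j" using base I by auto
  \<comment> \<open>With three rungs a chord would join the outer rungs of the base, which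
    \<open>block\<close> excludes; hence there are at least four.\<close>
  have "\<not> (i = -1 \<and> j = 1)" using no_short_chord ij by auto
  then have far: "i + 3 \<le> j" using b by auto
  have chord: "a = i \<and> b = j" if "f (a, k) ~ f (b, l)" "\<not> ladder_adj (a, k) (b, l)" "a \<in> I" "b \<in> I" "a \<le> b"
    for a b k l
    using chord_ends[OF that(3,4,5,1,2)] I by (auto simp: Icc_eq_Icc)
  have full_i: "v = f (i + 1, k') \<or> v = f (i, \<not> k') \<or> v = f (j, l')"
    if "f (i, k') ~ f (j, l')" "f (i, k') ~ v" for k' l' v
    using full[of "f (i, k')" "f (i + 1, k')" "f (i, \<not> k')" "f (j, l')" v] that far
      side_adj[of i k'] rung_adj[of i k'] by (auto simp: ladder_inj mem)
  have full_j: "v = f (j - 1, l') \<or> v = f (j, \<not> l') \<or> v = f (i, k')"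
    if "f (i, k') ~ f (j, l')" "f (j, l') ~ v" for k' l' v
    using full[of "f (j, l')" "f (j - 1, l')" "f (j, \<not> l')" "f (i, k')" v] that far
      side_adj[of "j - 1" l'] rung_adj[of j l'] sym by (auto simp: ladder_inj mem)
  have other: "f (i, \<not> k) ~ f (j, \<not> l)"
  proof -
    have mi: "i \<in> I" "i + 1 \<in> I" "j \<in> I" "j - 1 \<in> I" using far mem by auto
    obtain r s where rs: "f (i, k) ~ r" "r \<noteq> f (j, l)" "f (j, l) ~ s" "s \<noteq> f (i, k)" "r = s \<or> r ~ s"
      by (rule short[of "f (i, k)" "f (j, l)" "f (i + 1, k)" "f (j - 1, l)" "f (j, \<not> l)"])
        (use mi far ij(4) side_adj[of i k] side_adj[of "j - 1" l] rung_adj[of j l] sym in \<open>auto simp: ladder_inj\<close>)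
    have r: "r = f (i + 1, k) \<or> r = f (i, \<not> k)" and s: "s = f (j - 1, l) \<or> s = f (j, \<not> l)"
      using full_i[OF ij(4) rs(1)] full_j[OF ij(4) rs(3)] rs(2,4) by auto
    have "r \<noteq> s" using r s mi far by (auto simp: ladder_inj)
    then have "r ~ s" using rs by blast
    \<comment> \<open>This edge could only be a side edge of a ladder with exactly four rungs. One
      end of the chord is then a common neighbour of rungs -1 and 1 outside rung 0, against the
      separation of the base.\<close>
    have no1: "\<not> f (i + 1, k) ~ f (j - 1, l)"
    proof
      assume *: "f (i + 1, k) ~ f (j - 1, l)"
      then have "ladder_adj (i + 1, k) (j - 1, l)" using chord[OF *] mi far by auto
      then have "k = l" "j = i + 3" using far by (auto simp: ladder_adj_def)
      with b consider "i = -1" "j = 2" | "i = -2" "j = 1" by linarith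
      then show False
      proof cases
        case 1
        then show False
          using no_short_detour[of k "f (j, l)" l] ij(4) side_adj[of 1 l] mi sym \<open>k = l\<close> base
          by (auto simp: ladder_inj)
      next
        case 2
        then show False
          using no_short_detour[of k "f (i, k)" l] ij(4) side_adj[of "-2" k] mi sym \<open>k = l\<close> base
          by (auto simp: ladder_inj)
      qed
    qed
    have no2: "\<not> f (i + 1, k) ~ f (j, \<not> l)" using chord[of "i + 1" k j "\<not> l"] mi far
      by (auto simp: ladder_adj_def)
    have no3: "\<not> f (i, \<not> k) ~ f (j - 1, l)" using chord[of i "\<not> k" "j - 1" l] mi far
      by (auto simp: ladder_adj_def)
    show ?thesis using \<open>r ~ s\<close> r s no1 no2 no3 by blast
  qed
  let ?s = "k \<noteq> l"
  have ends: "f (i, k') ~ f (j, k' \<noteq> ?s)" for k'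
    using ij(4) other by (cases "k' = k") (cases k; cases l; cases k'; auto)+
    have A: "f (a, k') ~ f (b, l') \<longleftrightarrow> ladder_adj (a, k') (b, l') \<or> a = i \<and> b = j \<and> l' = (k' \<noteq> ?s)"
      if "a \<in> I" "b \<in> I" "a \<le> b" for a b k' l'
    proof
      assume *: "f (a, k') ~ f (b, l')"
      show "ladder_adj (a, k') (b, l') \<or> a = i \<and> b = j \<and> l' = (k' \<noteq> ?s)"
      proof (cases "ladder_adj (a, k') (b, l')")
        case False
        then have "a = i" "b = j" using chord[OF * _ that] by auto
        then show ?thesis
          using full_i[OF ends[of k'], of "f (j, l')"] * that far mem[of "i + 1"] by (auto simp: ladder_inj)
      qed simp
    next
      assume "ladder_adj (a, k') (b, l') \<or> a = i \<and> b = j \<and> l' = (k' \<noteq> ?s)"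
      then show "f (a, k') ~ f (b, l')" using strip_adj[OF strip, of "(a, k')" "(b, l')"] ends that by auto
    qed
    have B: "v \<in> f ` (I \<times> UNIV)" if aI: "a \<in> I" and av: "f (a, k') ~ v" for a k' v
    proof -
      have "\<exists>c m. c \<in> I \<and> v = f (c, m)"
      proof (cases "a - 1 \<in> I \<and> a + 1 \<in> I")
        case True
        then show ?thesis using interior[of a k' v] aI av by blast
      next
        case False
        then have "a = i \<or> a = j" using mem[of a] mem[of "a - 1"] mem[of "a + 1"] aI by linarith
        moreover have "f (i, k' \<noteq> ?s) ~ f (j, k')" using ends[of "k' \<noteq> ?s"] by (cases k'; cases ?s) auto
        moreover have "i + 1 \<in> I" "j - 1 \<in> I" using mem far by auto
        ultimately show ?thesis
          using full_i[OF ends[of k'], of v] full_j[of "k' \<noteq> ?s" k' v] av ij(1,2) by blast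
      qed
      then show ?thesis by auto
    qed
  show thesis
  proof (rule that[of i j ?s])
    show "\<forall>a\<in>I. \<forall>b\<in>I. \<forall>k' l'. a \<le> b \<longrightarrow>
        (f (a, k') ~ f (b, l') \<longleftrightarrow> ladder_adj (a, k') (b, l') \<or> a = i \<and> b = j \<and> (l' = (k' \<noteq> ?s)))"
      using A by simp
    show "\<forall>a\<in>I. \<forall>k' v. f (a, k') ~ v \<longrightarrow> v \<in> f ` (I \<times> UNIV)"
      using B by blast
  qed (use I far in auto)
qed

end

end

section \<open>Closed ladders\<close>

lemma mod_cycle_adj_le:
  assumes "a < n" "c < n" "a \<le> c" "3 \<le> n"
  shows "c = Suc a mod n \<or> a = Suc c mod n \<longleftrightarrow> c = Suc a \<or> a = 0 \<and> Suc c = n"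
  unfolding Suc_mod_if[OF assms(1)] Suc_mod_if[OF assms(2)] using assms
  by (cases "Suc a = n"; cases "Suc c = n"; simp; presburger)

lemma mod_cycle_adj:
  assumes "a < n" "c < n" "3 \<le> n"
  shows "c = Suc a mod n \<or> a = Suc c mod n \<longleftrightarrow>
    c = Suc a \<or> a = Suc c \<or> a = 0 \<and> Suc c = n \<or> c = 0 \<and> Suc a = n"
  unfolding Suc_mod_if[OF assms(1)] Suc_mod_if[OF assms(2)] using assms
  by (cases "Suc a = n"; cases "Suc c = n"; simp; presburger)

lemma prism_adj_le:
  assumes "fst u < n" "fst v < n" "fst u \<le> fst v" "3 \<le> n"
  shows "(u, v) \<in> edges (prism_graph n) \<longleftrightarrow> fst u = fst v \<and> snd u \<noteq> snd v \<or>
    fst v = Suc (fst u) \<and> snd u = snd v \<or> fst u = 0 \<and> Suc (fst v) = n \<and> snd v = snd u"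
proof -
  obtain a k c l where uv: "u = (a, k)" "v = (c, l)" by (cases u, cases v)
  have "(u, v) \<in> edges (prism_graph n) \<longleftrightarrow>
      a = c \<and> k \<noteq> l \<or> (c = Suc a mod n \<or> a = Suc c mod n) \<and> k = l"
    unfolding uv prism_graph_def mem_product_K2 mem_cycle_graph using assms uv by auto
  then show ?thesis using mod_cycle_adj_le[of a n c] assms uv by auto
qed

lemma prism_adj_sym: "(u, v) \<in> edges (prism_graph n) \<longleftrightarrow> (v, u) \<in> edges (prism_graph n)"
  unfolding prism_graph_def by (cases u; cases v) auto

text \<open>Folding the cycle of length \<open>2 * n\<close> into two layers turns antipodal pairs
  into rungs, and the cycle edges \<open>n - 1, n\<close> and \<open>2 * n - 1, 0\<close> into the
  two crossed closing edges.\<close>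

lemma moebius_fold_adj:
  fixes u v n :: nat
  defines "g \<equiv> \<lambda>t. if t < n then (t, False) else (t - n, True)"
  assumes "u < 2 * n" "v < 2 * n" "fst (g u) \<le> fst (g v)" "3 \<le> n"
  shows "v = Suc u \<or> u = Suc v \<or> u = 0 \<and> Suc v = 2 * n \<or> v = 0 \<and> Suc u = 2 * n \<or> v = u + n \<or> u = v + n \<longleftrightarrow>
    fst (g u) = fst (g v) \<and> snd (g u) \<noteq> snd (g v) \<or> fst (g v) = Suc (fst (g u)) \<and> snd (g u) = snd (g v) \<or>
    fst (g u) = 0 \<and> Suc (fst (g v)) = n \<and> snd (g v) = (\<not> snd (g u))"
proof (cases "u < n"; cases "v < n")
  assume "u < n" "v < n"
  then show ?thesis using assms by (simp; presburger)
next
  assume "u < n" "\<not> v < n"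
  then show ?thesis using assms by (simp; presburger)
next
  assume "\<not> u < n" "v < n"
  then show ?thesis using assms by (simp; presburger)
next
  assume "\<not> u < n" "\<not> v < n"
  then show ?thesis using assms by (simp; presburger)
qed

context flat_graph
begin

lemma closed_ladder_iso:
  assumes ml: "maximal_ladder I f" and ch: "\<not> chordless UNIV I f"
  shows "(\<exists>n\<ge>3. graph_isomorphic G (prism_graph n)) \<or> (\<exists>n\<ge>2. graph_isomorphic G (moebius_ladder n))"
proof -
  obtain i j s where I: "I = {i..j}" "i + 3 \<le> j"
    and adj: "\<forall>a\<in>I. \<forall>b\<in>I. \<forall>k l. a \<le> b \<longrightarrow>
       (f (a, k) ~ f (b, l) \<longleftrightarrow> ladder_adj (a, k) (b, l) \<or> a = i \<and> b = j \<and> (l = (k \<noteq> s)))"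
    and closed: "\<forall>a\<in>I. \<forall>k v. f (a, k) ~ v \<longrightarrow> v \<in> f ` (I \<times> UNIV)"
    by (rule ladder_closes[OF ml ch])
  define n where "n = nat (j - i + 1)"
  have n: "n \<ge> 4" "j = i + int n - 1" using I unfolding n_def by auto
  have mem: "i + int t \<in> I" if "t < n" for t using that I n by auto
  have adj': "f (i + int a, k) ~ f (i + int b, l) \<longleftrightarrow>
      a = b \<and> k \<noteq> l \<or> b = Suc a \<and> k = l \<or> a = 0 \<and> Suc b = n \<and> (l = (k \<noteq> s))"
    if "a < n" "b < n" "a \<le> b" for a b k l
    using adj[rule_format, OF mem[OF that(1)] mem[OF that(2)], of k l] that n by (auto simp: ladder_adj_def)
  \<comment> \<open>Adjacency in the ladder is known for ordered indices only, hence the symmetry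
    clause for \<open>H\<close> in \<open>le\<close>. The map \<open>g\<close> gives the rung and
    the side of each vertex of the model.\<close>
  have iso: "graph_isomorphic G H"
    if inj: "inj_on g (verts H)" and img: "g ` verts H = {..<n} \<times> UNIV" and
      le: "\<And>u v. u \<in> verts H \<Longrightarrow> v \<in> verts H \<Longrightarrow> fst (g u) \<le> fst (g v) \<Longrightarrow>
        ((u, v) \<in> edges H \<longleftrightarrow> (v, u) \<in> edges H) \<and>
        ((u, v) \<in> edges H \<longleftrightarrow> fst (g u) = fst (g v) \<and> snd (g u) \<noteq> snd (g v) \<or>
          fst (g v) = Suc (fst (g u)) \<and> snd (g u) = snd (g v) \<or>
          fst (g u) = 0 \<and> Suc (fst (g v)) = n \<and> (snd (g v) = (snd (g u) \<noteq> s)))"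
    for g and H :: "'b graph"
  proof (rule embeds_iso)
    let ?h = "\<lambda>u. f (i + int (fst (g u)), snd (g u))"
    have lt: "fst (g u) < n" if "u \<in> verts H" for u
    proof -
      have "g u \<in> {..<n} \<times> UNIV" using imageI[of u "verts H" g] img that by simp
      then show ?thesis by (auto simp: mem_Times_iff)
    qed
    have iff: "((u, v) \<in> edges H \<longleftrightarrow> (v, u) \<in> edges H) \<and> ((u, v) \<in> edges H \<longleftrightarrow> ?h u ~ ?h v)"
      if "u \<in> verts H" "v \<in> verts H" "fst (g u) \<le> fst (g v)" for u v
      unfolding adj'[OF lt[OF that(1)] lt[OF that(2)] that(3)] by (rule le[OF that])
    have "(u, v) \<in> edges H \<longleftrightarrow> ?h u ~ ?h v" if "u \<in> verts H" "v \<in> verts H" for u v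
      using iff[OF that] iff[OF that(2,1)] sym by (metis nat_le_linear)
    moreover have "inj_on ?h (verts H)"
    proof (rule inj_onI)
      fix u v assume uv: "u \<in> verts H" "v \<in> verts H" "?h u = ?h v"
      then have "g u = g v"
        using ladder_inj[OF ml mem[OF lt[OF uv(1)]] mem[OF lt[OF uv(2)]]]
        by (auto simp: prod_eq_iff)
      then show "u = v" using inj uv by (simp add: inj_on_eq_iff)
    qed
    moreover have "?h u \<in> verts G" if "u \<in> verts H" for u
      using strip_verts[OF strip[OF ml]] mem[OF lt[OF that]] by simp
    ultimately show "embeds H G ?h" unfolding embeds_def adj_def by auto
    have "(a, k) \<in> (\<lambda>(t, k). (i + int t, k)) ` ({..<n} \<times> UNIV)" if "a \<in> I" for a k
      using that I n by (intro image_eqI[of _ _ "(nat (a - i), k)"]) auto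
    then have IU: "I \<times> UNIV = (\<lambda>(t, k). (i + int t, k)) ` ({..<n} \<times> UNIV)"
      using mem by auto
    have "f ` (I \<times> UNIV) = f ` (\<lambda>(t, k). (i + int t, k)) ` g ` verts H" by (simp only: IU img)
    then have S: "f ` (I \<times> UNIV) = ?h ` verts H" by (simp add: image_image case_prod_beta)
    show "v \<in> ?h ` verts H" if "u \<in> verts H" "?h u ~ v" for u v
      using closed[rule_format, OF mem[OF lt[OF that(1)]] that(2)] S by simp
    show "verts H \<noteq> {}"
    proof
      assume "verts H = {}"
      then have "{..<n} \<times> (UNIV :: bool set) = {}" using img by simp
      then show False using n by (auto simp: lessThan_empty_iff)
    qed
  qed
  show ?thesis
  \<comment> \<open>A straight closing is the prism, a crossed one the Moebius ladder.\<close>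
  proof (cases s)
    case False
    have "graph_isomorphic G (prism_graph n)"
    proof (rule iso[of "\<lambda>x. x"])
      fix u v assume "u \<in> verts (prism_graph n)" "v \<in> verts (prism_graph n)" "fst u \<le> fst v"
      then have uv: "fst u < n" "fst v < n" "fst u \<le> fst v" by (auto simp: prism_graph_def)
      have "n \<ge> 3" using n(1) by simp
      have "(snd u \<noteq> s) = snd u" using False by simp
      then show "((u, v) \<in> edges (prism_graph n) \<longleftrightarrow> (v, u) \<in> edges (prism_graph n)) \<and>
          ((u, v) \<in> edges (prism_graph n) \<longleftrightarrow> fst u = fst v \<and> snd u \<noteq> snd v \<or>
            fst v = Suc (fst u) \<and> snd u = snd v \<or>
            fst u = 0 \<and> Suc (fst v) = n \<and> (snd v = (snd u \<noteq> s)))"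
        using prism_adj_le[OF uv \<open>n \<ge> 3\<close>] prism_adj_sym[of u v n] by (simp only: simp_thms)
    qed (simp_all add: prism_graph_def)
    then show ?thesis using n by auto
  next
    case True
    have "graph_isomorphic G (moebius_ladder n)"
    proof (rule iso[of "\<lambda>t. if t < n then (t, False) else (t - n, True)"])
      show "inj_on (\<lambda>t. if t < n then (t, False) else (t - n, True)) (verts (moebius_ladder n))"
        by (auto simp: inj_on_def split: if_splits)
      have "(a, k) \<in> (\<lambda>t. if t < n then (t, False) else (t - n, True)) ` {..<2 * n}" if "a < n" for a k
        using that by (intro image_eqI[of _ _ "if k then a + n else a"]) auto
      then show "(\<lambda>t. if t < n then (t, False) else (t - n, True)) ` verts (moebius_ladder n) = {..<n} \<times> UNIV"
        by (auto split: if_splits)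
      fix u v
      let ?g = "\<lambda>t. if t < n then (t, False) else (t - n, True)" and ?M = "edges (moebius_ladder n)"
      assume "u \<in> verts (moebius_ladder n)" "v \<in> verts (moebius_ladder n)" and le: "fst (?g u) \<le> fst (?g v)"
      then have uv: "u < 2 * n" "v < 2 * n" by auto
      have n2: "3 \<le> 2 * n" using n(1) by simp
      have M: "(u, v) \<in> ?M \<longleftrightarrow>
          v = Suc u \<or> u = Suc v \<or> u = 0 \<and> Suc v = 2 * n \<or> v = 0 \<and> Suc u = 2 * n \<or> v = u + n \<or> u = v + n"
        unfolding mem_moebius_ladder disj_assoc[symmetric] mod_cycle_adj[OF uv n2]
        by (simp add: uv disj_assoc)
      show "((u, v) \<in> ?M \<longleftrightarrow> (v, u) \<in> ?M) \<and>
          ((u, v) \<in> ?M \<longleftrightarrow> fst (?g u) = fst (?g v) \<and> snd (?g u) \<noteq> snd (?g v) \<or>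
            fst (?g v) = Suc (fst (?g u)) \<and> snd (?g u) = snd (?g v) \<or>
            fst (?g u) = 0 \<and> Suc (fst (?g v)) = n \<and> (snd (?g v) = (snd (?g u) \<noteq> s)))"
      proof
        show "(u, v) \<in> ?M \<longleftrightarrow> (v, u) \<in> ?M" unfolding mem_moebius_ladder by argo
        have "(snd (?g u) \<noteq> s) = (\<not> snd (?g u))" using True by simp
        then show "(u, v) \<in> ?M \<longleftrightarrow> fst (?g u) = fst (?g v) \<and> snd (?g u) \<noteq> snd (?g v) \<or>
            fst (?g v) = Suc (fst (?g u)) \<and> snd (?g u) = snd (?g v) \<or>
            fst (?g u) = 0 \<and> Suc (fst (?g v)) = n \<and> (snd (?g v) = (snd (?g u) \<noteq> s))"
          using M moebius_fold_adj[OF uv le] n(1) by simp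
      qed
    qed
    then show ?thesis using n by auto
  qed
qed

section \<open>Ends of ladders\<close>

text \<open>The map \<open>p\<close> realizes the new vertices of the modification \<open>e\<close> at \<open>x\<close>, \<open>y\<close> outside \<open>S\<close>.\<close>

definition end_attached :: "'a set \<Rightarrow> 'a \<Rightarrow> 'a \<Rightarrow> end_modification \<Rightarrow> (nat \<Rightarrow> 'a) \<Rightarrow> bool" where
  "end_attached S x y e p \<longleftrightarrow> inj_on p (new_verts e) \<and> p ` new_verts e \<subseteq> verts G - S \<and>
     (\<forall>t\<in>new_verts e. \<forall>w. p t ~ w \<longleftrightarrow>
        (\<exists>m. w = case_sum id p m \<and> (m, Inr t) \<in> new_edges e x y \<union> (new_edges e x y)\<inverse>)) \<and>
     (\<forall>w. x ~ w \<or> y ~ w \<longrightarrow> w \<in> S \<union> p ` new_verts e)"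

text \<open>The last premise supplies membership in \<open>verts G\<close>, since a vertex with a
  neighbour belongs to the graph.\<close>

lemma end_attachedI:
  assumes "\<And>w. x ~ w \<or> y ~ w \<Longrightarrow> w \<in> S \<union> p ` new_verts e"
    and "\<And>t. t \<in> new_verts e \<Longrightarrow> p t \<notin> S"
    and "inj_on p (new_verts e)"
    and "\<And>t w. t \<in> new_verts e \<Longrightarrow> p t ~ w \<longleftrightarrow>
        (\<exists>m. w = case_sum id p m \<and> (m, Inr t) \<in> new_edges e x y \<union> (new_edges e x y)\<inverse>)"
    and "\<And>t. t \<in> new_verts e \<Longrightarrow> \<exists>w. p t ~ w"
  shows "end_attached S x y e p"
  unfolding end_attached_def using assms adj_verts by blast

text \<open>Each vertex of the last rung has at most one outside neighbour. None gives E1 and one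
  gives E2; two different ones are nonadjacent by maximality and give E3; a common one gives E4 or
  E5. Short cycles make everything else pendant.\<close>

lemma right_end:
  assumes ml: "maximal_ladder I f" and cl: "chordless UNIV I f" and b: "b \<in> I" "b + 1 \<notin> I"
  shows "\<exists>e p. end_attached (f ` (I \<times> UNIV)) (f (b, False)) (f (b, True)) e p"
proof -
  let ?S = "f ` (I \<times> UNIV)"
  have base: "{-1, 0, 1} \<subseteq> I" using base[OF ml] .
  note conv = conv[OF ml]
  have b1: "b \<ge> 1" using convex_int_le_max[OF conv b, of 1] base by simp
  have mem: "b - 1 \<in> I" "b - 2 \<in> I"
    using convex_intD[OF conv, of "-1" b "b - 1"] convex_intD[OF conv, of "-1" b "b - 2"] b b1 base by auto
  have S: "f (i, k) \<in> ?S" if "i \<in> I" for i k using that by auto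
  have bS: "f (b, k) \<in> ?S" "f (b - 1, k) \<in> ?S" "f (b - 2, k) \<in> ?S" for k using S b mem by auto
  have e: "f (b, k) ~ f (b, \<not> k)" "f (b, k) ~ f (b - 1, k)" "f (b - 1, k) ~ f (b, k)" for k
    using rung_adj[OF ml b(1), of k] side_adj[OF ml, of "b - 1" k] mem b sym by auto
  have ne: "f (b, k) \<noteq> f (b, \<not> k)" "f (b - 1, k) \<noteq> f (b, l)" for k l
    using ladder_inj[OF ml] mem b by auto
  have X1: "w = f (b - 2, k) \<or> w = f (b, k) \<or> w = f (b - 1, \<not> k)" if "f (b - 1, k) ~ w" for w k
    using interior[OF ml, of "b - 1" k w] that mem b by (auto simp: algebra_simps)
  have inS: "w = f (b - 1, k) \<or> w = f (b, \<not> k)" if bw: "f (b, k) ~ w" "w \<in> ?S" for w k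
  proof -
    obtain i l where w: "w = f (i, l)" "i \<in> I" using bw(2) by auto
    then have "ladder_adj (b, k) (i, l)" using cl bw b unfolding chordless_def by auto
    moreover have "i \<noteq> b + 1" using w b by auto
    ultimately show ?thesis unfolding ladder_adj_def w by auto
  qed
  have out: "w = f (b - 1, k) \<or> w = f (b, \<not> k) \<or> w = p" if "f (b, k) ~ p" "p \<notin> ?S" "f (b, k) ~ w" for p w k
    using full[of "f (b, k)" "f (b - 1, k)" "f (b, \<not> k)" p w] e that ne bS by metis
  have out': "w = p \<or> w \<in> ?S" if "f (b, k) ~ p" "p \<notin> ?S" "f (b, k) ~ w" for p w k
    using out[OF that] bS(1)[of "\<not> k"] bS(2)[of k] by blast
  have no1: "\<not> p ~ f (b - 1, l)" if "p \<notin> ?S" for p l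
    using X1[of l p] that bS sym by metis
  \<comment> \<open>Rung \<open>b - 2\<close> is saturated if it is interior. Otherwise it is rung
    -1 and \<open>b = 1\<close>, so \<open>p\<close> would be a forbidden detour between the outer
    rungs of the base.\<close>
  have no2: "\<not> p ~ f (b - 2, l)" if p: "p \<notin> ?S" "f (b, k) ~ p" for p k l
  proof
    assume *: "p ~ f (b - 2, l)"
    show False
    proof (cases "b - 3 \<in> I")
      case True
      then have "p \<in> ?S"
        using interior[OF ml, of "b - 2" l p] mem sym[OF *] S[of "b - 3"] S[of "b - 1"] S[of "b - 2"]
        by (auto simp: algebra_simps)
      then show False using p by blast
    next
      case False
      then have "b = 1" using convex_int_ge_min[OF conv mem(2), of "-1"] base b1 by simp
      then have "p = f (0, False) \<or> p = f (0, True)"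
        using no_short_detour[OF ml, of l p k] sym[OF *] sym[OF p(2)] by simp
      then show False using S[of 0] base p by auto
    qed
  qed
  \<comment> \<open>The short cycle through the edge from \<open>p\<close> to the last rung cannot
    reach back to the rungs \<open>b - 1\<close> or \<open>b - 2\<close>, so it has to cross the
    last rung.\<close>
  have key: "p ~ f (b, \<not> k) \<or> (\<exists>q. q \<notin> ?S \<and> p ~ q \<and> f (b, \<not> k) ~ q)"
    if p: "f (b, k) ~ p" "p \<notin> ?S" "p ~ r" "r \<noteq> f (b, k)" for p r k
  proof -
    obtain r' s where rs: "p ~ r'" "r' \<noteq> f (b, k)" "f (b, k) ~ s" "s \<noteq> p" "r' = s \<or> r' ~ s"
      by (rule short[of p "f (b, k)" r "f (b - 1, k)" "f (b, \<not> k)"]) (use p e sym bS ne in metis)+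
    have "r' \<noteq> f (b - 1, k)" "r' \<noteq> f (b - 1, \<not> k)" "r' \<noteq> f (b - 2, k)"
      using no1 no2 p rs(1) by metis+
    moreover have "s = f (b - 1, k) \<or> s = f (b, \<not> k)" using out[OF p(1,2) rs(3)] rs(4) by blast
    ultimately have "r' = f (b, \<not> k) \<or> r' ~ f (b, \<not> k)"
      using X1[of k r'] rs sym by metis
    then show ?thesis
      using inS[of "\<not> k" r'] rs(1,2) sym \<open>r' \<noteq> f (b - 1, \<not> k)\<close> by (metis (full_types))
  qed
  let ?x = "f (b, False)" and ?y = "f (b, True)"
  have pend: "(\<forall>w. p ~ w \<longleftrightarrow> w = f (b, k)) \<or> (\<exists>q. q \<notin> ?S \<and> f (b, \<not> k) ~ q \<and> (q = p \<or> p ~ q))"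
    if p: "f (b, k) ~ p" "p \<notin> ?S" for p k
    using key[OF p] p sym by metis
  have "(\<forall>k p. f (b, k) ~ p \<longrightarrow> p \<in> ?S) \<or>
      (\<exists>k p. f (b, k) ~ p \<and> p \<notin> ?S \<and> (\<forall>q. f (b, \<not> k) ~ q \<longrightarrow> q \<in> ?S)) \<or>
      (\<exists>p q. ?x ~ p \<and> p \<notin> ?S \<and> ?y ~ q \<and> q \<notin> ?S)"
    unfolding all_bool_eq ex_bool_eq not_False_eq_True not_True_eq_False by blast
  then consider (none) "\<And>p k. f (b, k) ~ p \<Longrightarrow> p \<in> ?S"
    | (one) k p where "f (b, k) ~ p" "p \<notin> ?S" "\<And>q. f (b, \<not> k) ~ q \<Longrightarrow> q \<in> ?S"
    | (both) p q where "?x ~ p" "p \<notin> ?S" "?y ~ q" "q \<notin> ?S"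
    by blast
  then show ?thesis
  proof cases
    case none
    have "end_attached ?S ?x ?y E1 p" for p :: "nat \<Rightarrow> 'a" by (rule end_attachedI) (use none in auto)
    then show ?thesis by blast
  next
    case (one k p)
    have pn: "p ~ w \<longleftrightarrow> w = f (b, k)" for w using pend[OF one(1,2)] one(3) by blast
    have o: "w = p \<or> w \<in> ?S" if "f (b, l) ~ w" for l w
    proof (cases "l = k")
      case True
      then show ?thesis using out'[OF one(1,2), of w] that by blast
    next
      case False
      then have "l = (\<not> k)" by auto
      then show ?thesis using one(3) that by blast
    qed
    show ?thesis
    proof (cases k)
      case True
      have "end_attached ?S ?x ?y E2_snd (\<lambda>_. p)"
        by (rule end_attachedI) (use True pn one(2) o in auto)
      then show ?thesis by blast
    next
      case False
      have "end_attached ?S ?x ?y E2_fst (\<lambda>_. p)"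
        by (rule end_attachedI) (use False pn one(2) o in auto)
      then show ?thesis by blast
    qed
  next
    case (both p q)
    have o: "w = p \<or> w \<in> ?S" if "?x ~ w" for w
      using out'[OF both(1,2) that] .
    have o': "w = q \<or> w \<in> ?S" if "?y ~ w" for w
      using out'[OF both(3,4) that] .
    show ?thesis
    proof (cases "p = q")
      case False
      \<comment> \<open>If adjacent, \<open>p\<close> and \<open>q\<close> would form one more
        rung.\<close>
      have npq: "\<not> p ~ q"
      proof
        assume pq: "p ~ q"
        let ?h = "\<lambda>k. if k then q else p"
        have "\<not> maximal_strip UNIV I f"
          by (rule strip_extend[OF strip[OF ml] b, of ?h])
            (use False both pq sym[OF pq] in \<open>auto simp: inj_on_def\<close>)
        then show False using maximal[OF ml] by blast
      qed
      have "p ~ w \<longleftrightarrow> w = ?x" for w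
        using pend[OF both(1,2), unfolded not_False_eq_True] o' npq False both by blast
      moreover have "q ~ w \<longleftrightarrow> w = ?y" for w
        using pend[OF both(3,4), unfolded not_True_eq_False] o npq False both sym by blast
      ultimately have "end_attached ?S ?x ?y E3 (\<lambda>t. if t = 0 then p else q)"
        by (intro end_attachedI) (use False both in \<open>auto simp: inj_on_def dest: o o'\<close>)
      then show ?thesis by blast
    next
      case True
      have z: "p ~ ?x" "p ~ ?y" "p \<notin> ?S" "?x \<noteq> ?y" using both True sym ne(1)[of False] by auto
      have o2: "w = p \<or> w \<in> ?S" if "f (b, k) ~ w" for k w
        using o o' True that by (cases k) auto
      show ?thesis
      proof (cases "\<exists>w. p ~ w \<and> w \<noteq> ?x \<and> w \<noteq> ?y")
        case False
        then have "p ~ w \<longleftrightarrow> w = ?x \<or> w = ?y" for w using z by blast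
        then have "end_attached ?S ?x ?y E4 (\<lambda>_. p)"
          by (intro end_attachedI) (use z in \<open>auto simp: split_sum_ex dest: o2\<close>)
        then show ?thesis by blast
      next
        case True
        then obtain w where w: "p ~ w" "w \<noteq> ?x" "w \<noteq> ?y" by blast
        have P: "p ~ v \<longleftrightarrow> v = ?x \<or> v = ?y \<or> v = w" for v
          using full[of p ?x ?y w v] z w by blast
        have wp: "w ~ p" "w \<noteq> p" using w irrefl sym by auto
        have wk: "w \<noteq> f (b, k)" for k using w by (cases k) auto
        have pk: "f (b, k) ~ p" for k using z sym by (cases k) auto
        have nw: "\<not> f (b, k) ~ w" for k
          using out[OF pk z(3), of k w] wk[of "\<not> k"] wp(2) no1[OF z(3), of k] w(1) by blast
        \<comment> \<open>With a second neighbour of \<open>w\<close>, the short cycle through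
          \<open>w p\<close> would have to pass from \<open>w\<close> to a neighbour of the last
          rung other than \<open>p\<close>; those lie in rungs \<open>b\<close> and
          \<open>b - 1\<close> and are not adjacent to \<open>w\<close>.\<close>
        have pendant: "v = p" if wv: "w ~ v" for v
        proof (rule ccontr)
          assume "v \<noteq> p"
          obtain r s where rs: "w ~ r" "r \<noteq> p" "p ~ s" "s \<noteq> w" "r = s \<or> r ~ s"
            by (rule short[of w p v ?x ?y]) (use wp wv z w \<open>v \<noteq> p\<close> in auto)
          then obtain k where s: "s = f (b, k)" using P by blast
          then have "f (b, k) ~ r" using rs nw sym by metis
          then have "r = f (b - 1, k) \<or> r = f (b, \<not> k)"
            using out[OF pk z(3), of k r] rs(2) by blast
          moreover have "r \<noteq> f (b, \<not> k)" using nw rs(1) sym by blast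
          moreover have "\<not> f (b - 1, k) ~ w"
            using X1[of k w] no2[OF z(3) pk, of k] no1[OF z(3), of "\<not> k"] wk[of k] w(1) by blast
          ultimately show False using rs(1) sym by blast
        qed
        \<comment> \<open>Every ladder vertex has a neighbour on its own rung, whereas the only
          neighbour of \<open>w\<close> lies outside the ladder.\<close>
        have wS: "w \<notin> ?S"
        proof
          assume "w \<in> ?S"
          then obtain i k where "w = f (i, k)" "i \<in> I" by auto
          then have "w ~ f (i, \<not> k)" "f (i, \<not> k) \<in> ?S" using rung_adj[OF ml] by auto
          then show False using pendant z by blast
        qed
        have W: "w ~ v \<longleftrightarrow> v = p" for v using pendant wp by blast
        have "end_attached ?S ?x ?y E5 (\<lambda>t. if t = 0 then p else w)"
        proof (rule end_attachedI)
          fix t v assume "t \<in> new_verts E5"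
          then consider "t = 0" | "t = 1" by auto
          then show "(if t = 0 then p else w) ~ v \<longleftrightarrow>
            (\<exists>m. v = case_sum id (\<lambda>t. if t = 0 then p else w) m \<and>
              (m, Inr t) \<in> new_edges E5 ?x ?y \<union> (new_edges E5 ?x ?y)\<inverse>)"
          proof cases
            case 1
            then show ?thesis using P[of v] by (auto simp: split_sum_ex)
          next
            case 2
            then show ?thesis using W[of v] by (auto simp: split_sum_ex)
          qed
        qed (use z wS wp in \<open>auto simp: inj_on_def dest: o2\<close>)
        then show ?thesis by blast
      qed
    qed
  qed
qed

section \<open>Gluing the end modifications\<close>

text \<open>The image of the whole model \<open>H\<close> plays the role of \<open>S\<close>, so the
  lemma applies twice: at the second end the new vertices of the first one count as old.\<close>

lemma embeds_modify_end:
  assumes g: "embeds H G g" and xy: "x \<in> verts H" "y \<in> verts H"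
    and a: "end_attached (g ` verts H) (g x) (g y) e p"
  shows "embeds (modify_end e x y H) G (case_sum g p)"
proof -
  let ?g = "case_sum g p"
  have g': "inj_on g (verts H)" "g ` verts H \<subseteq> verts G"
    "\<And>u v. u \<in> verts H \<Longrightarrow> v \<in> verts H \<Longrightarrow> (u, v) \<in> edges H \<longleftrightarrow> g u ~ g v"
    using g unfolding embeds_def adj_def by auto
  have p: "inj_on p (new_verts e)" "\<And>t. t \<in> new_verts e \<Longrightarrow> p t \<in> verts G"
    "\<And>t u. t \<in> new_verts e \<Longrightarrow> u \<in> verts H \<Longrightarrow> p t \<noteq> g u"
    using a unfolding end_attached_def by auto
  have padj: "p t ~ w \<longleftrightarrow> (\<exists>m. w = case_sum id p m \<and>
      (m, Inr t) \<in> new_edges e (g x) (g y) \<union> (new_edges e (g x) (g y))\<inverse>)"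
    if "t \<in> new_verts e" for t w
    using a that unfolding end_attached_def by blast
  have gxy: "g u = g x \<longleftrightarrow> u = x" "g u = g y \<longleftrightarrow> u = y" if "u \<in> verts H" for u
    using g'(1) xy that by (auto simp: inj_on_eq_iff)
  have new: "(Inl u, Inr t) \<in> edges (modify_end e x y H) \<longleftrightarrow> g u ~ p t"
    "(Inr t, Inl u) \<in> edges (modify_end e x y H) \<longleftrightarrow> p t ~ g u"
    if "t \<in> new_verts e" "u \<in> verts H" for t u
  proof -
    have "p t ~ g u \<longleftrightarrow> (Inl u, Inr t) \<in> new_edges e x y"
      unfolding padj[OF that(1)] using that p(3)[OF _ that(2)] p(3)[OF _ that(2), THEN not_sym] gxy[OF that(2)]
      by (cases e) (auto simp: split_sum_ex)
    moreover have "(Inr t, Inl u) \<notin> new_edges e x y" by (cases e) auto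
    ultimately show "(Inl u, Inr t) \<in> edges (modify_end e x y H) \<longleftrightarrow> g u ~ p t"
      "(Inr t, Inl u) \<in> edges (modify_end e x y H) \<longleftrightarrow> p t ~ g u"
      using sym by (auto simp: modify_end_def)
  qed
  have nn: "(Inr t, Inr s) \<in> edges (modify_end e x y H) \<longleftrightarrow> p t ~ p s"
    if "t \<in> new_verts e" "s \<in> new_verts e" for t s
    unfolding padj[OF that(1)] using that p(1) p(3)[OF that(2) xy(1)] p(3)[OF that(2) xy(2)]
    by (cases e) (auto simp: modify_end_def inj_on_def split_sum_ex)
  have old: "(Inl u, Inl v) \<in> edges (modify_end e x y H) \<longleftrightarrow> g u ~ g v"
    if "u \<in> verts H" "v \<in> verts H" for u v
    using g'(3)[OF that] by (cases e) (auto simp: modify_end_def)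
  have V: "verts (modify_end e x y H) = Inl ` verts H \<union> Inr ` new_verts e"
    by (simp add: modify_end_def)
  have "inj_on ?g (Inl ` verts H \<union> Inr ` new_verts e)"
    by (rule inj_onI)
      (auto simp: inj_on_eq_iff[OF g'(1)] inj_on_eq_iff[OF p(1)] p(3) p(3)[THEN not_sym])
  moreover have "?g ` (Inl ` verts H \<union> Inr ` new_verts e) \<subseteq> verts G" using g'(2) p(2) by auto
  moreover have "(u, v) \<in> edges (modify_end e x y H) \<longleftrightarrow> ?g u ~ ?g v"
    if "u \<in> Inl ` verts H \<union> Inr ` new_verts e" "v \<in> Inl ` verts H \<union> Inr ` new_verts e" for u v
    using that by (elim UnE imageE) (simp_all add: new nn old)
  ultimately show ?thesis unfolding embeds_def V adj_def by blast
qed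

text \<open>The second alternative of the last claim is for the pendant vertex of E5, the only new
  vertex not adjacent to \<open>x\<close> or \<open>y\<close>.\<close>

lemma end_attached_nbrs:
  assumes a: "end_attached S x y e p" and t: "t \<in> new_verts e"
  shows "p t ~ w \<Longrightarrow> w \<in> {x, y} \<union> p ` new_verts e"
    and "(p t ~ x \<or> p t ~ y) \<or> (\<exists>s\<in>new_verts e. p t ~ p s \<and> (p s ~ x \<or> p s ~ y))"
proof -
  have padj: "p t ~ w \<longleftrightarrow> (\<exists>m. w = case_sum id p m \<and>
      (m, Inr t) \<in> new_edges e x y \<union> (new_edges e x y)\<inverse>)" if "t \<in> new_verts e" for t w
    using a that unfolding end_attached_def by blast
  show "w \<in> {x, y} \<union> p ` new_verts e" if "p t ~ w"
    using that t unfolding padj[OF t] by (cases e) (auto simp: split_sum_ex)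
  show "(p t ~ x \<or> p t ~ y) \<or> (\<exists>s\<in>new_verts e. p t ~ p s \<and> (p s ~ x \<or> p s ~ y))"
  proof (cases "e = E5 \<and> t = 1")
    case True
    then have "p 1 ~ p 0" "p 0 ~ x" by (subst padj; force simp: split_sum_ex)+
    then show ?thesis using True by auto
  next
    case False
    then have "p t ~ x \<or> p t ~ y"
      unfolding padj[OF t] using t False by (cases e) (auto simp: split_sum_ex)
    then show ?thesis by blast
  qed
qed

text \<open>The neighbours of a new vertex inside \<open>S\<close> belong to its own end, so a
  shared new vertex would touch both pairs. If it is the pendant vertex of E5, the same argument is
  applied to its neighbour.\<close>

lemma end_attached_disjoint:
  assumes a: "end_attached S x y e p" and a': "end_attached S x' y' e' p'"
    and S: "{x, y, x', y'} \<subseteq> S" "{x, y} \<inter> {x', y'} = {}"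
  shows "p ` new_verts e \<inter> p' ` new_verts e' = {}"
proof -
  have out: "p t \<notin> S" if "t \<in> new_verts e" for t using a that unfolding end_attached_def by blast
  have out': "p' t \<notin> S" if "t \<in> new_verts e'" for t using a' that unfolding end_attached_def by blast
  have near: "w \<in> {x, y}" if "t \<in> new_verts e" "p t ~ w" "w \<in> S" for t w
    using end_attached_nbrs(1)[OF a that(1,2)] out that(3) by blast
  have near': "w \<in> {x', y'}" if "t \<in> new_verts e'" "p' t ~ w" "w \<in> S" for t w
    using end_attached_nbrs(1)[OF a' that(1,2)] out' that(3) by blast
  have False if t: "t \<in> new_verts e" "t' \<in> new_verts e'" "p t = p' t'" for t t'
    using end_attached_nbrs(2)[OF a t(1)]
  proof
    assume "p t ~ x \<or> p t ~ y"
    then show False using near'[OF t(2)] t(3) S by auto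
  next
    assume "\<exists>s\<in>new_verts e. p t ~ p s \<and> (p s ~ x \<or> p s ~ y)"
    then obtain s where s: "s \<in> new_verts e" "p t ~ p s" "p s ~ x \<or> p s ~ y" by blast
    then have "p s \<in> {x', y'} \<union> p' ` new_verts e'" using end_attached_nbrs(1)[OF a' t(2)] t(3) by metis
    then obtain s' where "s' \<in> new_verts e'" "p s = p' s'" using out[OF s(1)] S by blast
    then show False using near'[of s'] s(3) S by auto
  qed
  then show ?thesis by blast
qed

lemma end_attached_extend:
  assumes a: "end_attached S x y e p" and "T \<inter> p ` new_verts e = {}"
  shows "end_attached (S \<union> T) x y e p"
  using assms unfolding end_attached_def by blast

lemma left_end:
  assumes ml: "maximal_ladder I f" and cl: "chordless UNIV I f" and b: "b \<in> I" "b - 1 \<notin> I"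
  shows "\<exists>e p. end_attached (f ` (I \<times> UNIV)) (f (b, False)) (f (b, True)) e p"
proof -
  let ?f = "\<lambda>(i, k). f (- i, k)" and ?I = "uminus ` I"
  have "chordless UNIV ?I ?f"
    unfolding chordless_def
  proof (intro ballI impI)
    fix p q assume pq: "p \<in> ?I \<times> UNIV" "q \<in> ?I \<times> UNIV" "?f p ~ ?f q"
    obtain i k j l where ij: "p = (i, k)" "q = (j, l)" by (cases p, cases q)
    have "- i \<in> I" "- j \<in> I" using pq unfolding ij by auto
    then have "ladder_adj (- i, k) (- j, l)"
      using cl pq(3) unfolding ij chordless_def by simp
    then show "ladder_adj p q" unfolding ij ladder_adj_def by auto
  qed
  moreover have "- b + 1 \<notin> ?I"
  proof
    assume "- b + 1 \<in> ?I"
    then obtain t where "t \<in> I" "- b + 1 = - t" by blast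
    moreover from this have "t = b - 1" by simp
    ultimately show False using b by simp
  qed
  ultimately have "\<exists>e p. end_attached (?f ` (?I \<times> UNIV)) (f (b, False)) (f (b, True)) e p"
    using right_end[OF maximal_ladder_reflect[OF ml], of "- b"] b by simp
  moreover have "?f ` (?I \<times> UNIV) = f ` (I \<times> UNIV)" by force
  ultimately show ?thesis by simp
qed

lemma ladder_classification:
  assumes ml: "maximal_ladder I f" and cl: "chordless UNIV I f"
  shows "(\<exists>m\<ge>1. \<exists>e e'. graph_isomorphic G (restricted_quasi_ladder m e e')) \<or>
    graph_isomorphic G infinite_ladder \<or>
    (\<exists>e. graph_isomorphic G (restricted_infinite_quasi_ladder e))"
proof -
  note strip = strip[OF ml]
  let ?S = "f ` (I \<times> UNIV)"
  have emb: "embeds H G (f \<circ> h)"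
    if "inj_on h (verts H)" "h ` verts H = I \<times> UNIV"
      "\<And>u v. u \<in> verts H \<Longrightarrow> v \<in> verts H \<Longrightarrow> (u, v) \<in> edges H \<longleftrightarrow> ladder_adj (h u) (h v)"
    for h and H :: "'b graph"
    using strip_embeds[OF strip cl] that by blast
  have inner: "v \<in> ?S" if "i - 1 \<in> I" "i + 1 \<in> I" "f (i, k) ~ v" for i k v
  proof -
    have "i \<in> I" using convex_intD[OF conv[OF ml] that(1,2), of i] by simp
    then show ?thesis using interior[OF ml that] that by auto
  qed
  \<comment> \<open>The function \<open>c\<close> counts rungs away from the bounded end, downwards
    or upwards, which merges the two one-sided shapes.\<close>
  have half: "\<exists>e. graph_isomorphic G (restricted_infinite_quasi_ladder e)"
    if h: "(\<lambda>(n, k :: bool). (c n, k)) ` (UNIV \<times> UNIV) = I \<times> UNIV" "inj c"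
      "\<And>i j. c i = c j + 1 \<or> c j = c i + 1 \<longleftrightarrow> i = Suc j \<or> j = Suc i"
      and e: "\<exists>e p. end_attached ?S (f (c 0, False)) (f (c 0, True)) e p"
      and inn: "\<And>n. n > 0 \<Longrightarrow> c n - 1 \<in> I \<and> c n + 1 \<in> I"
    for c :: "nat \<Rightarrow> int"
  proof -
    obtain e p where a: "end_attached ?S (f (c 0, False)) (f (c 0, True)) e p" using e by blast
    let ?h = "\<lambda>(n, k :: bool). (c n, k)" and ?H = half_infinite_ladder
    have vH: "verts ?H = UNIV \<times> UNIV" unfolding half_infinite_ladder_def by simp
    have hI: "?h ` verts ?H = I \<times> UNIV" unfolding vH by (rule h(1))
    have "embeds ?H G (f \<circ> ?h)"
    proof (rule emb[OF _ hI])
      show "inj_on ?h (verts ?H)" using h(2) by (auto simp: inj_on_def)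
      show "(u, v) \<in> edges ?H \<longleftrightarrow> ladder_adj (?h u) (?h v)" for u v
        using h(2) h(3)[of "fst u" "fst v"] unfolding half_infinite_ladder_def ladder_adj_def
        by (cases u; cases v) (auto simp: inj_eq)
    qed
    moreover have S: "(f \<circ> ?h) ` verts ?H = ?S" using hI by (simp only: image_comp[symmetric])
    ultimately have em: "embeds (restricted_infinite_quasi_ladder e) G (case_sum (f \<circ> ?h) p)"
      unfolding restricted_infinite_quasi_ladder_def
      by (intro embeds_modify_end) (use a vH in auto)
    have V: "case_sum (f \<circ> ?h) p ` verts (restricted_infinite_quasi_ladder e) = ?S \<union> p ` new_verts e"
      unfolding restricted_infinite_quasi_ladder_def modify_end_def
      using S by (simp add: image_Un image_image)
    have "graph_isomorphic G (restricted_infinite_quasi_ladder e)"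
    proof (rule embeds_iso[OF em])
      show "verts (restricted_infinite_quasi_ladder e) \<noteq> {}"
        unfolding restricted_infinite_quasi_ladder_def modify_end_def using vH by simp
      have cl: "v \<in> ?S \<union> p ` new_verts e" if uS: "u \<in> ?S \<union> p ` new_verts e" and uv: "u ~ v" for u v
      proof (cases "u \<in> ?S")
        case True
        then have "u \<in> f ` ?h ` verts ?H" unfolding hI .
        then obtain n k where u: "u = f (c n, k)" by auto
        show ?thesis
        proof (cases "n = 0")
          case True
          then have "f (c 0, False) ~ v \<or> f (c 0, True) ~ v" using u \<open>u ~ v\<close> by (cases k) auto
          then show ?thesis using a unfolding end_attached_def by blast
        next
          case False
          then show ?thesis using inner inn[of n] u \<open>u ~ v\<close> by auto
        qed
      next
        case False
        with uS obtain t where "t \<in> new_verts e" "u = p t" by blast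
        moreover have "f (c 0, k) \<in> ?S" for k
        proof -
          have "(c 0, k) \<in> I \<times> UNIV"
            unfolding hI[symmetric] vH by (intro image_eqI[of _ _ "(0, k)"]) auto
          then show ?thesis by (rule imageI)
        qed
        ultimately show ?thesis using end_attached_nbrs(1)[OF a] uv by blast
      qed
      show "v \<in> case_sum (f \<circ> ?h) p ` verts (restricted_infinite_quasi_ladder e)"
        if "u \<in> verts (restricted_infinite_quasi_ladder e)" "case_sum (f \<circ> ?h) p u ~ v" for u v
        unfolding V by (rule cl[OF _ that(2)]) (use V that(1) in blast)
    qed
    then show ?thesis by blast
  qed
  have "convex_int I" "0 \<in> I" using conv[OF ml] base[OF ml] by auto
  then show ?thesis
  proof (cases rule: convex_int_cases)
    case UNIV
    have "graph_isomorphic G infinite_ladder"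
    proof (rule embeds_iso)
      show "embeds infinite_ladder G (f \<circ> (\<lambda>x. x))"
        by (rule emb) (auto simp: UNIV infinite_ladder_def ladder_adj_def)
      show "v \<in> (f \<circ> (\<lambda>x. x)) ` verts infinite_ladder" if "(f \<circ> (\<lambda>x. x)) u ~ v" for u v
        using inner[of "fst u" "snd u" v] that by (simp add: UNIV infinite_ladder_def)
    qed (simp add: infinite_ladder_def)
    then show ?thesis by blast
  next
    case (below b)
    have "\<exists>e. graph_isomorphic G (restricted_infinite_quasi_ladder e)"
    proof (rule half[of "\<lambda>n. b - int n"])
      show "(\<lambda>(n, k :: bool). (b - int n, k)) ` (UNIV \<times> UNIV) = I \<times> UNIV"
      proof
        show "I \<times> UNIV \<subseteq> (\<lambda>(n, k :: bool). (b - int n, k)) ` (UNIV \<times> UNIV)"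
        proof
          fix x assume "x \<in> I \<times> (UNIV :: bool set)"
          then obtain i k where "x = (i, k)" "i \<le> b" using below by auto
          then show "x \<in> (\<lambda>(n, k :: bool). (b - int n, k)) ` (UNIV \<times> UNIV)"
            by (intro image_eqI[of _ _ "(nat (b - i), k)"]) auto
        qed
      qed (use below in auto)
      show "\<exists>e p. end_attached ?S (f (b - int 0, False)) (f (b - int 0, True)) e p"
        using right_end[OF ml cl, of b] below by simp
    qed (use below in \<open>auto simp: inj_def\<close>)
    then show ?thesis by blast
  next
    case (above b)
    have "\<exists>e. graph_isomorphic G (restricted_infinite_quasi_ladder e)"
    proof (rule half[of "\<lambda>n. b + int n"])
      show "(\<lambda>(n, k :: bool). (b + int n, k)) ` (UNIV \<times> UNIV) = I \<times> UNIV"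
      proof
        show "I \<times> UNIV \<subseteq> (\<lambda>(n, k :: bool). (b + int n, k)) ` (UNIV \<times> UNIV)"
        proof
          fix x assume "x \<in> I \<times> (UNIV :: bool set)"
          then obtain i k where "x = (i, k)" "b \<le> i" using above by auto
          then show "x \<in> (\<lambda>(n, k :: bool). (b + int n, k)) ` (UNIV \<times> UNIV)"
            by (intro image_eqI[of _ _ "(nat (i - b), k)"]) auto
        qed
      qed (use above in auto)
      show "\<exists>e p. end_attached ?S (f (b + int 0, False)) (f (b + int 0, True)) e p"
        using left_end[OF ml cl, of b] above by simp
    qed (use above in \<open>auto simp: inj_def\<close>)
    then show ?thesis by blast
  next
    case (bounded a b)
    have ab: "a \<le> -1" "1 \<le> b" using base[OF ml] bounded by auto
    define m where "m = nat (b - a + 1)"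
    have m: "m \<ge> 3" "b = a + int (m - 1)" using ab unfolding m_def by auto
    obtain e p where e: "end_attached ?S (f (a, False)) (f (a, True)) e p"
      using left_end[OF ml cl, of a] bounded ab by auto
    obtain e' p' where e': "end_attached ?S (f (b, False)) (f (b, True)) e' p'"
      using right_end[OF ml cl, of b] bounded ab by auto
    have inS: "f (a, k) \<in> ?S" "f (b, k) \<in> ?S" for k using bounded ab by auto
    have aneb: "f (a, k) \<noteq> f (b, l)" for k l using ladder_inj[OF ml, of a b k l] bounded ab by auto
    \<comment> \<open>The second modification is glued to the ladder together with the new vertices
      of the first, which it must avoid.\<close>
    have disj: "p ` new_verts e \<inter> p' ` new_verts e' = {}"
      by (rule end_attached_disjoint[OF e e']) (use inS aneb aneb[THEN not_sym] in auto)
    let ?h = "\<lambda>(n, k :: bool). (a + int n, k)"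
    have vH: "verts (finite_ladder m) = {..<m} \<times> UNIV" unfolding finite_ladder_def by simp
    have hI: "?h ` verts (finite_ladder m) = I \<times> UNIV"
    proof -
      have "(i, k) \<in> ?h ` ({..<m} \<times> UNIV)" if "a \<le> i" "i \<le> b" for i and k :: bool
        using that m by (intro image_eqI[of _ _ "(nat (i - a), k)"]) auto
      then show ?thesis unfolding vH using bounded m by auto
    qed
    have "embeds (finite_ladder m) G (f \<circ> ?h)"
    proof (rule emb[OF _ hI])
      show "inj_on ?h (verts (finite_ladder m))" by (auto simp: inj_on_def)
      show "(u, v) \<in> edges (finite_ladder m) \<longleftrightarrow> ladder_adj (?h u) (?h v)"
        if "u \<in> verts (finite_ladder m)" "v \<in> verts (finite_ladder m)" for u v
        using that unfolding vH unfolding finite_ladder_def ladder_adj_def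
        by (cases u; cases v) auto
    qed
    moreover have S: "(f \<circ> ?h) ` verts (finite_ladder m) = ?S" using hI by (simp only: image_comp[symmetric])
    ultimately have em1: "embeds (modify_end e (0, False) (0, True) (finite_ladder m)) G (case_sum (f \<circ> ?h) p)"
      by (intro embeds_modify_end) (use e vH m in auto)
    have V1: "case_sum (f \<circ> ?h) p ` verts (modify_end e (0, False) (0, True) (finite_ladder m))
        = ?S \<union> p ` new_verts e"
      unfolding modify_end_def using S by (simp add: image_Un image_image)
    let ?R = "restricted_quasi_ladder m e e'" and ?g = "case_sum (case_sum (f \<circ> ?h) p) p'"
    have bm: "b = a + int (m - Suc 0)" using m(2) by simp
    have em: "embeds ?R G ?g"
      unfolding restricted_quasi_ladder_def
    proof (rule embeds_modify_end[OF em1])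
      show "end_attached (case_sum (f \<circ> ?h) p ` verts (modify_end e (0, False) (0, True) (finite_ladder m)))
          (case_sum (f \<circ> ?h) p (Inl (m - 1, False))) (case_sum (f \<circ> ?h) p (Inl (m - 1, True))) e' p'"
        unfolding V1 using end_attached_extend[OF e' disj] by (simp add: bm)
    qed (use m in \<open>auto simp: modify_end_def vH\<close>)
    have V: "?g ` verts ?R = ?S \<union> p ` new_verts e \<union> p' ` new_verts e'"
      unfolding restricted_quasi_ladder_def modify_end_def[of e']
      using V1 by (simp add: image_Un image_image)
    have cl: "v \<in> ?S \<union> p ` new_verts e \<union> p' ` new_verts e'"
      if uS: "u \<in> ?S \<union> p ` new_verts e \<union> p' ` new_verts e'" and uv: "u ~ v" for u v
    proof -
      consider (S) "u \<in> ?S" | (p) "u \<in> p ` new_verts e" | (p') "u \<in> p' ` new_verts e'" using uS by blast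
      then show ?thesis
      proof cases
        case S
        then obtain i k where u: "u = f (i, k)" "i \<in> I" by auto
        show ?thesis
        proof (cases "i = a \<or> i = b")
          case True
          then have "(f (a, False) ~ v \<or> f (a, True) ~ v) \<or> (f (b, False) ~ v \<or> f (b, True) ~ v)"
            using u \<open>u ~ v\<close> by (cases k) auto
          then show ?thesis using e e' unfolding end_attached_def by blast
        next
          case False
          then have "i - 1 \<in> I" "i + 1 \<in> I" using u(2) bounded by auto
          then show ?thesis using inner u \<open>u ~ v\<close> by blast
        qed
      next
        case p
        then show ?thesis using end_attached_nbrs(1)[OF e] uv inS by blast
      next
        case p'
        then show ?thesis using end_attached_nbrs(1)[OF e'] uv inS by blast
      qed
    qed
    have "graph_isomorphic G ?R"
    proof (rule embeds_iso[OF em])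
      show "verts ?R \<noteq> {}"
        unfolding restricted_quasi_ladder_def modify_end_def using vH m by (auto simp: lessThan_empty_iff)
      show "v \<in> ?g ` verts ?R" if "u \<in> verts ?R" "?g u ~ v" for u v
        unfolding V by (rule cl[OF _ that(2)]) (use V that(1) in blast)
    qed
    then show ?thesis using m by (metis one_le_numeral order_trans)
  qed
qed

section \<open>Degree two and the final case distinction\<close>

lemma geodesic6_exists:
  assumes "6 \<le> gdiameter G"
  obtains w where "geodesic w 6"
proof -
  have "\<exists>u\<in>verts G. \<exists>v\<in>verts G. 6 \<le> gdist G u v"
  proof (rule ccontr)
    assume "\<not> ?thesis"
    then have "gdiameter G \<le> enat 5"
      unfolding gdiameter_def by (intro SUP_least) (force simp: not_le)
    with assms have "6 \<le> enat 5" by (rule order_trans)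
    then show False by (simp add: numeral_eq_enat)
  qed
  then obtain u v where uv: "u \<in> verts G" "v \<in> verts G" "6 \<le> gdist G u v" by blast
  obtain w where "geodesic w (gdist G u v)" by (rule geodesic_exists[OF uv(1,2)])
  from geodesic_sub[OF this, of 0 6] uv(3) show thesis by (intro that) auto
qed

text \<open>Consider a vertex \<open>v\<close> of degree 3 nearest to \<open>w 3\<close>, reached
  through vertices of degree at most 2. The short cycle through the last edge gives the vertex two
  steps before \<open>v\<close> a second way towards \<open>v\<close>, and hence too many
  neighbours, unless it is \<open>w 3\<close> itself; then the cycle contradicts the
  geodesic.\<close>

lemma degree2_everywhere:
  assumes g: "geodesic w 6" and v3: "\<And>x. w 3 ~ x \<Longrightarrow> x = w 2 \<or> x = w 4"
  shows "\<not> (u ~ a \<and> u ~ b \<and> u ~ c \<and> a \<noteq> b \<and> a \<noteq> c \<and> b \<noteq> c)"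
proof
  assume u0: "u ~ a \<and> u ~ b \<and> u ~ c \<and> a \<noteq> b \<and> a \<noteq> c \<and> b \<noteq> c"
  \<comment> \<open>Degree at least 3, phrased by witnesses because \<open>short\<close> and
    \<open>full\<close> work with named neighbours.\<close>
  define D where "D v \<longleftrightarrow> (\<exists>a b c. v ~ a \<and> v ~ b \<and> v ~ c \<and> a \<noteq> b \<and> a \<noteq> c \<and> b \<noteq> c)" for v
  have "D u" using u0 unfolding D_def by blast
  then obtain v where v: "D v" "\<And>v'. D v' \<Longrightarrow> gdist G (w 3) v \<le> gdist G (w 3) v'"
    using ex_has_least_nat[of D u "gdist G (w 3)"] by blast
  let ?n = "gdist G (w 3) v"
  have V: "w 3 \<in> verts G" "v \<in> verts G"
    using g v(1) adj_verts unfolding geodesic_def D_def by auto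
  obtain p where p: "geodesic p ?n" "p 0 = w 3" "p ?n = v" by (rule geodesic_exists[OF V])
  note pf = geodesic_facts[OF p(1)] and far = geodesic_facts[OF g]
  have nD: "\<not> D (p i)" if "i < ?n" for i
  proof
    assume "D (p i)"
    have "(w 3, p i) \<in> edges G ^^ i"
      unfolding relpow_fun_conv using p(2) pf(1) that by (intro exI[of _ p]) (auto simp: adj_def)
    then have "gdist G (w 3) (p i) \<le> i" by (rule gdist_le)
    then show False using v(2)[OF \<open>D (p i)\<close>] that by simp
  qed
  have only2: "z = x \<or> z = y" if "\<not> D q" "q ~ x" "q ~ y" "x \<noteq> y" "q ~ z" for q x y z
    using that unfolding D_def by metis
  have w4: "z = w 3 \<or> z = w 5" if "w 4 ~ z" for z
    using geodesic_degree2_spread[OF g v3 that] .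
  have w2: "z = w 3 \<or> z = w 1" if "w 2 ~ z" for z
    using geodesic_degree2_spread[OF geodesic_rev[OF g], of z] v3 that by auto
  have "\<not> D (w 2)" "\<not> D (w 3)" "\<not> D (w 4)" unfolding D_def using v3 w2 w4 by metis+
  then have vn: "v \<noteq> w 2" "v \<noteq> w 3" "v \<noteq> w 4" using v(1) by auto
  then have "?n \<noteq> 0" using p by (metis p(2,3))
  moreover have "?n \<noteq> 1"
  proof
    assume "?n = 1"
    then have "w 3 ~ v" using pf(1)[of 0] p by simp
    then show False using v3 vn by blast
  qed
  ultimately have n2: "?n \<ge> 2" by linarith
  define x y where "x = p (?n - 1)" and "y = p (?n - 2)"
  have xy: "x ~ v" "y ~ x" "y \<noteq> v" "\<not> y ~ v" "\<not> D x" "\<not> D y"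
    using pf(1)[of "?n - 1"] pf(1)[of "?n - 2"] pf(2)[of "?n - 2" ?n] pf(3)[of "?n - 2" ?n]
      nD[of "?n - 1"] nD[of "?n - 2"] n2 p(3)
    unfolding x_def y_def by (auto simp: Suc_diff_le numeral_2_eq_2 Suc_diff_Suc)
  obtain b c where bc: "v ~ b" "v ~ c" "b \<noteq> x" "c \<noteq> x" "b \<noteq> c"
    using v(1) unfolding D_def by metis
  \<comment> \<open>As \<open>x\<close> has no third neighbour, the short cycle must continue
    through its predecessor \<open>y\<close>.\<close>
  obtain r s where rs: "x ~ r" "r \<noteq> v" "v ~ s" "s \<noteq> x" "r = s \<or> r ~ s"
    by (rule short[OF xy(1) sym[OF xy(2)] xy(3) bc])
  have "r = y" using only2[OF xy(5) sym[OF xy(2)] xy(1) xy(3) rs(1)] rs(2) by blast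
  then have s: "y ~ s" "s ~ v" using rs xy(4) sym by auto
  show False
  proof (cases "?n \<ge> 3")
    case True
    let ?q = "p (?n - 3)"
    have "Suc (?n - 3) = ?n - 2" using True by simp
    then have "?q ~ y" using pf(1)[of "?n - 3"] True unfolding y_def by simp
    moreover have "?q \<noteq> x" "\<not> ?q ~ v"
      using pf(2)[of "?n - 3" "?n - 1"] pf(3)[of "?n - 3" ?n] True p(3) unfolding x_def by auto
    ultimately show False
      using only2[OF xy(6) xy(2) sym[OF \<open>?q ~ y\<close>] _ s(1)] rs(4) s(2) by auto
  next
    \<comment> \<open>At distance 2 no earlier vertex exists; instead \<open>x\<close> and
      \<open>s\<close> are the two neighbours \<open>w 2\<close> and \<open>w 4\<close> of
      \<open>w 3\<close>, whose other neighbours are known.\<close>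
    case False
    then have "?n = 2" using n2 by simp
    then have y: "y = w 3" using p(2) unfolding y_def by simp
    then have "x = w 2 \<or> x = w 4" "s = w 2 \<or> s = w 4" using v3 xy(2) s(1) by auto
    then consider "x = w 2" "s = w 4" | "x = w 4" "s = w 2" using rs(4) by blast
    then show False
    proof cases
      case 1
      then have "v = w 1" using w2 xy(1) vn by blast
      then show False using far(3)[of 1 4] s(2) 1 sym by auto
    next
      case 2
      then have "v = w 5" using w4 xy(1) vn by blast
      then show False using far(3)[of 2 5] s(2) 2 by auto
    qed
  qed
qed

text \<open>Seed of the maximal path: the three middle vertices, shifted by 3 so that
  \<open>w 3\<close> gets index 0.\<close>

lemma geodesic_strip:
  assumes g: "geodesic w 6"
  shows "strip {False} {-1, 0, 1} (\<lambda>(i, k). w (nat (i + 3)))"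
  unfolding strip_def
proof (intro conjI)
  note far = geodesic_facts[OF g]
  note e = geodesic6[OF g] geodesic6[OF g, THEN sym]
  show "convex_int {-1, 0, 1}" unfolding convex_int_def by auto
  show "inj_on (\<lambda>(i, k). w (nat (i + 3))) ({-1, 0, 1} \<times> {False})"
    using far(2)[of 2 3] far(2)[of 2 4] far(2)[of 3 4] by (auto simp: inj_on_def)
  show "(\<lambda>(i, k). w (nat (i + 3))) ` ({-1, 0, 1} \<times> {False}) \<subseteq> verts G"
    using g unfolding geodesic_def by auto
  show "\<forall>p\<in>{-1, 0, 1} \<times> {False}. \<forall>q\<in>{-1, 0, 1} \<times> {False}. ladder_adj p q \<longrightarrow>
      (case p of (i, k) \<Rightarrow> w (nat (i + 3))) ~ (case q of (i, k) \<Rightarrow> w (nat (i + 3)))"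
    using e by (auto simp: ladder_adj_def)
qed

lemma classification:
  assumes "6 \<le> gdiameter G"
  shows "(\<exists>n\<ge>1. graph_isomorphic G (path_graph n)) \<or>
    (\<exists>n\<ge>3. graph_isomorphic G (cycle_graph n)) \<or>
    (\<exists>n\<ge>3. graph_isomorphic G (prism_graph n)) \<or>
    (\<exists>n\<ge>2. graph_isomorphic G (moebius_ladder n)) \<or>
    (\<exists>m\<ge>1. \<exists>e e'. graph_isomorphic G (restricted_quasi_ladder m e e')) \<or>
    graph_isomorphic G both_side_line \<or>
    graph_isomorphic G one_side_line \<or>
    graph_isomorphic G infinite_ladder \<or>
    (\<exists>e. graph_isomorphic G (restricted_infinite_quasi_ladder e))"
proof -
  obtain w where g: "geodesic w 6" by (rule geodesic6_exists[OF assms])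
  show ?thesis
  proof (cases "\<exists>x. w 3 ~ x \<and> x \<noteq> w 2 \<and> x \<noteq> w 4")
    case True
    then obtain a0 a1 b0 b1 c0 c1 where b: "block a0 a1 b0 b1 c0 c1" using block_exists[OF g] by blast
    obtain I f where ml: "maximal_ladder I f" by (rule maximal_ladder_exists[OF b])
    show ?thesis using closed_ladder_iso[OF ml] ladder_classification[OF ml] by blast
  next
    case False
    then have v3: "x = w 2 \<or> x = w 4" if "w 3 ~ x" for x using that by blast
    have "card (nbrs G u) \<le> 2" if u: "u \<in> verts G" for u
    proof (rule ccontr)
      assume "\<not> ?thesis"
      then have "3 \<le> card (nbrs G u)" by simp
      then obtain T where T: "T \<subseteq> nbrs G u" "card T = 3" by (rule obtain_subset_with_card_n) auto
      then obtain a b c where "T = {a, b, c}" "a \<noteq> b" "a \<noteq> c" "b \<noteq> c" by (auto simp: card_3_iff)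
      then show False using degree2_everywhere[OF g v3, of u a b c] T(1) unfolding nbrs_def adj_def by auto
    qed
    moreover obtain I f where "maximal_strip {False} I f" "{-1, 0, 1} \<subseteq> I"
      by (rule maximal_strip_exists[OF geodesic_strip[OF g]]) auto
    ultimately show ?thesis using path_classification by blast
  qed
qed

end

lemma graph_isomorphic_finite: "graph_isomorphic G H \<Longrightarrow> finite (verts G) \<longleftrightarrow> finite (verts H)"
  unfolding graph_isomorphic_def using bij_betw_finite by blast

lemma finite_new_verts: "finite (new_verts e)"
  by (cases e) auto

lemma finite_models:
  "finite (verts (path_graph n))" "finite (verts (cycle_graph n))" "finite (verts (prism_graph n))"
  "finite (verts (moebius_ladder n))" "finite (verts (restricted_quasi_ladder n e e'))"
  by (simp_all add: prism_graph_def restricted_quasi_ladder_def modify_end_def finite_ladder_def finite_new_verts)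

lemma infinite_models:
  "infinite (verts both_side_line)" "infinite (verts one_side_line)" "infinite (verts infinite_ladder)"
  "infinite (verts (restricted_infinite_quasi_ladder e))"
  by (auto simp: infinite_ladder_def restricted_infinite_quasi_ladder_def modify_end_def half_infinite_ladder_def
      infinite_UNIV_int finite_prod dest!: finite_imageD)

lemma flat_graphI:
  assumes G: "simple_graph G" "connected_graph G" "locally_finite_graph G"
    and curv: "nonneg_ollivier_curvature G" and deg3: "\<forall>v\<in>verts G. deg G v \<le> 3"
  shows "flat_graph G"
proof
  fix u v a b c
  assume uv: "(u, v) \<in> edges G" and ua: "(u, a) \<in> edges G" "a \<noteq> v"
    and vb: "(v, b) \<in> edges G" "(v, c) \<in> edges G" "b \<noteq> u" "c \<noteq> u" "b \<noteq> c"
  have "u \<in> verts G" "v \<in> verts G" "(v, u) \<in> edges G"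
    using G(1) uv unfolding simple_graph_def sym_def by blast+
  then have fin: "finite (nbrs G u)" "finite (nbrs G v)" using G(3) unfolding locally_finite_graph_def by auto
  have "card {a, v} \<le> deg G u" "card {u, b, c} \<le> deg G v"
    unfolding deg_def using fin uv ua vb \<open>(v, u) \<in> edges G\<close> by (intro card_mono; simp add: nbrs_def)+
  \<comment> \<open>The worst case is \<open>1/2 + 1/3\<close>, still below 1.\<close>
  then have d: "2 \<le> real (deg G u)" "3 \<le> real (deg G v)" using ua vb by auto
  have "1 / real (deg G u) \<le> 1 / 2" "1 / real (deg G v) \<le> 1 / 3" using d by (simp_all add: field_simps)
  then have "1 / real (deg G u) + 1 / real (deg G v) < 1" by linarith
  moreover have "0 \<le> ollivier_curvature G u v" using curv uv unfolding nonneg_ollivier_curvature_def by blast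
  ultimately show "\<exists>r s. (u, r) \<in> edges G \<and> r \<noteq> v \<and> (v, s) \<in> edges G \<and> s \<noteq> u \<and> (r = s \<or> (r, s) \<in> edges G)"
    using nonneg_curvature_short_cycle[OF G(1,2) uv fin] by blast
qed (use assms in auto)

theorem theorem2p6:
  fixes G :: "'a graph"
  assumes "simple_graph G"
    and "connected_graph G"
    and "locally_finite_graph G"
    and "nonneg_ollivier_curvature G"
    and "\<forall>v\<in>verts G. deg G v \<le> 3"
    and "6 \<le> gdiameter G"
  shows "(finite (verts G) \<longrightarrow>
            (\<exists>n\<ge>1. graph_isomorphic G (path_graph n)) \<or>
            (\<exists>n\<ge>3. graph_isomorphic G (cycle_graph n)) \<or>
            (\<exists>n\<ge>3. graph_isomorphic G (prism_graph n)) \<or>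
            (\<exists>n\<ge>2. graph_isomorphic G (moebius_ladder n)) \<or>
            (\<exists>m\<ge>1. \<exists>e e'. graph_isomorphic G (restricted_quasi_ladder m e e'))) \<and>
         (infinite (verts G) \<longrightarrow>
            graph_isomorphic G both_side_line \<or>
            graph_isomorphic G one_side_line \<or>
            graph_isomorphic G infinite_ladder \<or>
            (\<exists>e. graph_isomorphic G (restricted_infinite_quasi_ladder e)))"
proof -
  interpret flat_graph G by (rule flat_graphI[OF assms(1-5)])
  show ?thesis
    using classification[OF assms(6)] graph_isomorphic_finite finite_models infinite_models by meson
qed

end
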